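(* Let $(k,l)$ be a pair of relatively prime integers with $k>l>0$. Then the interior Fraser-Sargent surface $IFS_{k,l}$ satisfies $$\mathrm{Ind}(IFS_{k,l})\ge\begin{cases}2k-1,&k\text{ odd},\\ k-1,&k\text{ even}.\end{cases}$$
   Context: Notation: $\mathbb E^n$ is Euclidean $n$-space, $\mathbb B^n$ and $\mathring{\mathbb B}^n$ are the closed and open unit balls centered at the origin. Interior Fraser-Sargent surfaces. For relatively prime integers $k>l>0$ let $T_{k,l}$ be the unique positive solution of $k\tanh(kt)=l\coth(lt)$, let $r=\sqrt{k^2\sinh^2(lT_{k,l})+l^2\cosh^2(kT_{k,l})}$, and let $$u(t,\theta)=\tfrac1r\,(k\sinh lt\cos l\theta,\;k\sinh lt\sin l\theta,\;l\cosh kt\cos k\theta,\;l\cosh kt\sin k\theta),\quad t\in\mathbb R,\ \theta\in\mathbb R/2\pi\mathbb Z,$$ a conformal minimal immersion into $\mathbb E^4$ meeting $\partial\mathbb B^4$ orthogonally along $t=\pm T_{k,l}$. $IFS_{k,l}$ is the free boundary minimal surface in $\mathbb B^4$ obtained from $u$ restricted to $[-T_{k,l},T_{k,l}]\times(\mathbb R/2\pi\mathbb Z)$: if $k$ is odd it is this annulus immersed by $u$; if $k$ is even, $u$ is invariant under the fixed-point-free involution $(t,\theta)\mapsto(-t,\theta+\pi)$ and $IFS_{k,l}$ is the quotient Möbius band immersed by the induced map. Index. For a free boundary minimal surface $\Sigma$ in $\mathbb B^n$ (zero mean curvature, boundary in $\partial\mathbb B^n$, meeting $\partial\mathbb B^n$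 orthogonally), with normal bundle $N\Sigma$, normal connection $\nabla^\bot$, second fundamental form $b_{ij}=(\nabla_{e_i}e_j)^\bot$ in a local orthonormal tangent frame $e_1,e_2$, and $\mathcal B(X)=\sum_{i,j}\langle b_{ij},X\rangle b_{ij}$, the second variation of area on $X\in\Gamma(N\Sigma)$ is $$\delta^2A(X)=\int_\Sigma(|\nabla^\bot X|^2-\langle\mathcal B(X),X\rangle)\,dA-\int_{\partial\Sigma}|X|^2\,dL.$$ For a bounded domain $\Omega\subset\Sigma$ (which may contain boundary points of $\Sigma$), $\mathrm{Ind}(\Omega)$ is the maximal dimension of a space of smooth sections of $N\Sigma$ supported in $\Omega$ on which $\delta^2A$ is negative definite, and $\mathrm{Ind}(\Sigma)=\sup_\Omega\mathrm{Ind}(\Omega)$. Remark on the derivation (not a hypothesis of the statement): the paper deduces the bound from its computation of the index of the complete surface given by $u$ on all of $\mathbb R\times(\mathbb R/2\pi\mathbb Z)$ (modulo the involution for even $k$), together with the stability (index zero) of the exterior free boundary minimal surface in $\mathbb E^4\setminus\mathring{\mathbb B}^4$ given by $u$ on $[T_{k,l},+\infty)\times(\mathbb R/2\pi\mathbb Z)$; the paper states the latter as a conjecture and supports it by a computer-assisted (numerical) proof. *)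

theory Defs
  imports "HOL-Analysis.Analysis" "HOL-Library.Function_Algebras" "HOL-Library.Extended_Nat"
begin

text \<open>Pointwise real vector space structure on functions, so that \<open>subspace\<close>, \<open>span\<close> and \<open>dim\<close>
  apply to spaces of sections.\<close>

instantiation "fun" :: (type, real_vector) real_vector
begin

definition scaleR_fun_def: "scaleR c f = (\<lambda>x. c *\<^sub>R f x)"

instance
  by standard (simp_all add: scaleR_fun_def fun_eq_iff algebra_simps)

end

fun higher_diff_on :: "nat \<Rightarrow> 'a::real_normed_vector set \<Rightarrow> ('a \<Rightarrow> 'b::real_normed_vector) \<Rightarrow> bool" where
  "higher_diff_on 0 U f \<longleftrightarrow> continuous_on U f"
| "higher_diff_on (Suc n) U f \<longleftrightarrow>
     (\<forall>p\<in>U. f differentiable (at p)) \<and>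
     (\<forall>v. higher_diff_on n U (\<lambda>p. frechet_derivative f (at p) v))"

text \<open>On a set that is not open, smoothness means having a smooth extension to an open
  neighbourhood; for the closed strip below this is smoothness up to the boundary.\<close>

definition smooth_up_to :: "'a::real_normed_vector set \<Rightarrow> ('a \<Rightarrow> 'b::real_normed_vector) \<Rightarrow> bool" where
  "smooth_up_to S f \<longleftrightarrow>
     (\<exists>U g. open U \<and> S \<subseteq> U \<and> (\<forall>n. higher_diff_on n U g) \<and> (\<forall>p\<in>S. f p = g p))"


section \<open>Second variation and index of a surface covered by a strip\<close>

text \<open>A surface \<open>\<Sigma>\<close> with boundary is given by a conformal immersion \<open>f\<close> of the strip
  \<open>{-T..T} \<times> \<real>\<close> and a transformation \<open>\<sigma>\<close> of the plane preserving the strip, with \<open>f \<circ> \<sigma> = f\<close>: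
  \<open>\<Sigma>\<close> is the quotient of the strip by the infinite cyclic group generated by \<open>\<sigma>\<close>, and \<open>P\<close> is
  such that \<open>{-T..T} \<times> {0..P}\<close> is a fundamental domain. Subsets of \<open>\<Sigma>\<close> are represented by their
  (\<open>\<sigma>\<close>-invariant) preimages in the strip. Sections of the normal bundle of \<open>\<Sigma>\<close> are represented
  by their \<open>\<sigma>\<close>-invariant pullbacks to the strip, vectors normal to \<open>\<Sigma>\<close> being regarded as
  vectors of the ambient space.\<close>

definition strip :: "real \<Rightarrow> (real \<times> real) set" where
  "strip T = {-T..T} \<times> UNIV"

text \<open>The derivative of \<open>X\<close> at \<open>p\<close> in the direction \<open>v\<close>, one-sided at boundary points.\<close>

definition dir_deriv ::
    "real \<Rightarrow> (real \<times> real \<Rightarrow> 'a::real_normed_vector) \<Rightarrow> real \<times> real \<Rightarrow> real \<times> real \<Rightarrow> 'a" where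
  "dir_deriv T X p v = frechet_derivative X (at p within strip T) v"

text \<open>The normalized coordinate vector fields, indexed by \<open>Basis = {(1,0), (0,1)}\<close>. They form an
  orthonormal frame for the metric induced by \<open>f\<close> because \<open>f\<close> is conformal.\<close>

definition frame_field ::
    "real \<Rightarrow> (real \<times> real \<Rightarrow> 'a::euclidean_space) \<Rightarrow> real \<times> real \<Rightarrow> real \<times> real \<Rightarrow> real \<times> real" where
  "frame_field T f i p = i /\<^sub>R norm (dir_deriv T f p i)"

definition tangent_frame ::
    "real \<Rightarrow> (real \<times> real \<Rightarrow> 'a::euclidean_space) \<Rightarrow> real \<times> real \<Rightarrow> real \<times> real \<Rightarrow> 'a" where
  "tangent_frame T f i p = dir_deriv T f p (frame_field T f i p)"

definition normal_part ::
    "real \<Rightarrow> (real \<times> real \<Rightarrow> 'a::euclidean_space) \<Rightarrow> real \<times> real \<Rightarrow> 'a \<Rightarrow> 'a" where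
  "normal_part T f p w =
     w - (\<Sum>i\<in>Basis. (w \<bullet> tangent_frame T f i p) *\<^sub>R tangent_frame T f i p)"

definition normal_deriv ::
    "real \<Rightarrow> (real \<times> real \<Rightarrow> 'a::euclidean_space) \<Rightarrow> (real \<times> real \<Rightarrow> 'a)
      \<Rightarrow> real \<times> real \<Rightarrow> real \<times> real \<Rightarrow> 'a" where
  "normal_deriv T f X i p = normal_part T f p (dir_deriv T X p (frame_field T f i p))"

definition second_fund_form ::
    "real \<Rightarrow> (real \<times> real \<Rightarrow> 'a::euclidean_space)
      \<Rightarrow> real \<times> real \<Rightarrow> real \<times> real \<Rightarrow> real \<times> real \<Rightarrow> 'a" where
  "second_fund_form T f i j p =
     normal_part T f p (dir_deriv T (tangent_frame T f j) p (frame_field T f i p))"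

definition simons_op ::
    "real \<Rightarrow> (real \<times> real \<Rightarrow> 'a::euclidean_space) \<Rightarrow> real \<times> real \<Rightarrow> 'a \<Rightarrow> 'a" where
  "simons_op T f p w =
     (\<Sum>i\<in>Basis. \<Sum>j\<in>Basis. (second_fund_form T f i j p \<bullet> w) *\<^sub>R second_fund_form T f i j p)"

definition area_density ::
    "real \<Rightarrow> (real \<times> real \<Rightarrow> 'a::euclidean_space) \<Rightarrow> real \<times> real \<Rightarrow> real" where
  "area_density T f p =
     (let a = dir_deriv T f p (1, 0); b = dir_deriv T f p (0, 1)
      in sqrt ((norm a)\<^sup>2 * (norm b)\<^sup>2 - (a \<bullet> b)\<^sup>2))"

text \<open>The boundary of \<open>\<Sigma>\<close> is covered by the segments \<open>t = \<plusminus>T\<close>, \<open>0 \<le> \<theta> \<le> P\<close>, which overlap only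
  in end points (also when \<open>\<Sigma>\<close> is a Moebius band and the two segments join to form a single
  circle).\<close>

definition second_variation ::
    "real \<Rightarrow> (real \<times> real \<Rightarrow> 'a::euclidean_space) \<Rightarrow> real \<Rightarrow> (real \<times> real \<Rightarrow> 'a) \<Rightarrow> real" where
  "second_variation T f P X =
     integral ({-T..T} \<times> {0..P})
       (\<lambda>p. ((\<Sum>i\<in>Basis. (norm (normal_deriv T f X i p))\<^sup>2) - simons_op T f p (X p) \<bullet> X p)
             * area_density T f p)
     - (\<Sum>\<tau>\<in>{-T, T}. integral {0..P}
         (\<lambda>\<theta>. (norm (X (\<tau>, \<theta>)))\<^sup>2 * norm (dir_deriv T f (\<tau>, \<theta>) (0, 1))))"

text \<open>Domains of \<open>\<Sigma>\<close>, open relative to \<open>\<Sigma>\<close> and hence allowed to contain boundary points. The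
  third line is connectedness of the image of \<open>W\<close> in the quotient, which does not entail
  connectedness of \<open>W\<close>. Boundedness holds automatically here, as \<open>\<Sigma>\<close> is compact.\<close>

definition surface_domain ::
    "real \<Rightarrow> (real \<times> real \<Rightarrow> 'a::euclidean_space) \<Rightarrow> (real \<times> real \<Rightarrow> real \<times> real)
      \<Rightarrow> (real \<times> real) set \<Rightarrow> bool" where
  "surface_domain T f \<sigma> W \<longleftrightarrow>
     W \<noteq> {} \<and> openin (top_of_set (strip T)) W \<and> \<sigma> ` W = W \<and> bounded (f ` W) \<and>
     (\<forall>A B. openin (top_of_set (strip T)) A \<and> openin (top_of_set (strip T)) B \<and>
        \<sigma> ` A = A \<and> \<sigma> ` B = B \<and> A \<union> B = W \<and> A \<inter> B = {} \<longrightarrow> A = {} \<or> B = {})"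

text \<open>Smooth sections of the normal bundle of \<open>\<Sigma>\<close> with support in \<open>W\<close>. Since functions in HOL
  are total, a section is normalized to vanish off the strip, so that distinct functions
  represent distinct sections.\<close>

definition normal_sections ::
    "real \<Rightarrow> (real \<times> real \<Rightarrow> 'a::euclidean_space) \<Rightarrow> (real \<times> real \<Rightarrow> real \<times> real)
      \<Rightarrow> (real \<times> real) set \<Rightarrow> (real \<times> real \<Rightarrow> 'a) set" where
  "normal_sections T f \<sigma> W =
     {X. smooth_up_to (strip T) X \<and>
         (\<forall>p. p \<notin> strip T \<longrightarrow> X p = 0) \<and>
         (\<forall>p\<in>strip T. \<forall>v. X p \<bullet> dir_deriv T f p v = 0) \<and>
         (\<forall>p\<in>strip T. X (\<sigma> p) = X p) \<and>
         closure {p. X p \<noteq> 0} \<subseteq> W}"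

definition index_on ::
    "real \<Rightarrow> (real \<times> real \<Rightarrow> 'a::euclidean_space) \<Rightarrow> (real \<times> real \<Rightarrow> real \<times> real) \<Rightarrow> real
      \<Rightarrow> (real \<times> real) set \<Rightarrow> enat" where
  "index_on T f \<sigma> P W =
     (SUP V \<in> {V. subspace V \<and> (\<exists>B. finite B \<and> V = span B) \<and> V \<subseteq> normal_sections T f \<sigma> W \<and>
                  (\<forall>X\<in>V. X \<noteq> 0 \<longrightarrow> second_variation T f P X < 0)}. enat (dim V))"

definition surface_index ::
    "real \<Rightarrow> (real \<times> real \<Rightarrow> 'a::euclidean_space) \<Rightarrow> (real \<times> real \<Rightarrow> real \<times> real) \<Rightarrow> real \<Rightarrow> enat"
    where
  "surface_index T f \<sigma> P = (SUP W \<in> {W. surface_domain T f \<sigma> W}. index_on T f \<sigma> P W)"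


section \<open>Interior Fraser-Sargent surfaces\<close>

definition coth :: "real \<Rightarrow> real" where
  "coth x = cosh x / sinh x"

definition FS_T :: "nat \<Rightarrow> nat \<Rightarrow> real" where
  "FS_T k l = (THE t. 0 < t \<and> real k * tanh (real k * t) = real l * coth (real l * t))"

definition FS_r :: "nat \<Rightarrow> nat \<Rightarrow> real" where
  "FS_r k l = sqrt ((real k)\<^sup>2 * (sinh (real l * FS_T k l))\<^sup>2 + (real l)\<^sup>2 * (cosh (real k * FS_T k l))\<^sup>2)"

definition FS_u :: "nat \<Rightarrow> nat \<Rightarrow> real \<times> real \<Rightarrow> real ^ 4" where
  "FS_u k l = (\<lambda>(t, \<theta>). (1 / FS_r k l) *\<^sub>R
     vector [real k * sinh (real l * t) * cos (real l * \<theta>),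
             real k * sinh (real l * t) * sin (real l * \<theta>),
             real l * cosh (real k * t) * cos (real k * \<theta>),
             real l * cosh (real k * t) * sin (real k * \<theta>)])"

text \<open>For odd \<open>k\<close> the quotient of the strip is the annulus. For even \<open>k\<close> it is the Moebius band:
  the square of \<open>(t, \<theta>) \<mapsto> (-t, \<theta> + \<pi>)\<close> is the translation by the period \<open>2\<pi>\<close> of \<open>\<theta>\<close>, so a single
  generator accounts for both the periodicity and the involution.\<close>

definition FS_deck :: "nat \<Rightarrow> real \<times> real \<Rightarrow> real \<times> real" where
  "FS_deck k = (\<lambda>(t, \<theta>). if odd k then (t, \<theta> + 2 * pi) else (- t, \<theta> + pi))"

definition FS_period :: "nat \<Rightarrow> real" where
  "FS_period k = (if odd k then 2 * pi else pi)"

definition IFS_index :: "nat \<Rightarrow> nat \<Rightarrow> enat" where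
  "IFS_index k l = surface_index (FS_T k l) (FS_u k l) (FS_deck k) (FS_period k)"

end

theory Submission
  imports Defs
begin

text \<open>
  Write \<open>\<real>\<^sup>4 = \<complex>\<^sup>2\<close>, let \<open>\<mu> = k tanh (k T) = l coth (l T)\<close>, and for a field \<open>h\<close> along the surface that is
  tangent to the sphere at the boundary let \<open>X\<close> be the normal part of \<open>h\<close>. The second variation
  of area on \<open>X\<close> is at most the second variation \<open>\<integral>\<bar>\<nabla>h\<bar>\<^sup>2 - \<mu> \<integral>\<^sub>\<partial> \<bar>h\<bar>\<^sup>2\<close> of the energy on \<open>h\<close>, the
  difference being the integral of a sum of squares. Take \<open>h = (i e\<^sup>i\<^sup>l\<^sup>\<theta> (b - i a), 0)\<close> harmonic, with
  boundary values \<open>a = 0\<close> and \<open>b\<close> a real trigonometric polynomial of degree less than \<open>k\<close>, the same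
  on both boundary components. Rotational symmetry separates the Fourier modes, and mode \<open>j\<close>
  contributes a positive multiple of
  \<open>(l + j) tanh ((l + j) T) + (l - j) tanh ((l - j) T) - 2 \<mu>\<close>. By the addition theorem for \<open>tanh\<close> and
  \<open>\<mu> tanh (l T) = l\<close>, this is negative if and only if \<open>j tanh (j T) < k tanh (k T)\<close>, that is, if
  \<open>\<bar>j\<bar> < k\<close>. There are \<open>2 k - 1\<close> such modes; for even \<open>k\<close> the fields with odd \<open>j\<close> descend to the
  Moebius band, and there are \<open>k\<close> of these.
\<close>

section \<open>Smooth functions\<close>

text \<open>Differentiability gives continuity, which starts the induction. In the product rule this
  supplies the lower order for the undifferentiated factors.\<close>

lemma higher_diff_on_Suc_D:
  fixes f :: "'a::real_normed_vector \<Rightarrow> 'b::real_normed_vector"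
  shows "higher_diff_on (Suc n) UNIV f \<Longrightarrow> higher_diff_on n UNIV f"
proof (induction n arbitrary: f)
  case 0
  then show ?case
    by (auto simp: continuous_on_eq_continuous_at intro: differentiable_imp_continuous_within)
next
  case (Suc n)
  from Suc.prems have "\<forall>p\<in>UNIV. f differentiable (at p)"
    and "\<And>v. higher_diff_on (Suc n) UNIV (\<lambda>p. frechet_derivative f (at p) v)"
    by (subst (asm) higher_diff_on.simps(2); blast)+
  with Suc.IH show ?case
    by (subst higher_diff_on.simps(2)) blast
qed

text \<open>Any pointwise derivative may be supplied in place of \<open>frechet_derivative\<close>,
  so that the inductions below run on explicit formulas.\<close>

lemma higher_diff_on_SucI:
  assumes "\<And>p. (f has_derivative f' p) (at p)"
    and "\<And>v. higher_diff_on n UNIV (\<lambda>p. f' p v)"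
  shows "higher_diff_on (Suc n) UNIV f"
proof -
  have "frechet_derivative f (at p) = f' p" for p
    using frechet_derivative_at[OF assms(1)] by simp
  with assms show ?thesis
    by (auto simp: differentiable_def)
qed

lemma higher_diff_on_SucE:
  assumes "higher_diff_on (Suc n) UNIV f"
  obtains f' where "\<And>p. (f has_derivative f' p) (at p)"
    and "\<And>v. higher_diff_on n UNIV (\<lambda>p. f' p v)"
proof (rule that[of "\<lambda>p. frechet_derivative f (at p)"])
  show "(f has_derivative frechet_derivative f (at p)) (at p)" for p
    using assms by (simp add: frechet_derivative_works)
  show "higher_diff_on n UNIV (\<lambda>p. frechet_derivative f (at p) v)" for v
    using assms by simp
qed

lemma higher_diff_on_const [intro]: "higher_diff_on n UNIV (\<lambda>p. c)"
proof (induction n arbitrary: c)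
  case (Suc n)
  show ?case
    by (rule higher_diff_on_SucI[where f' = "\<lambda>p v. 0"]) (auto intro: Suc)
qed auto

lemma higher_diff_on_bounded_linear:
  assumes "bounded_linear g" and "higher_diff_on n UNIV f"
  shows "higher_diff_on n UNIV (\<lambda>p. g (f p))"
  using assms(2)
proof (induction n arbitrary: f)
  case 0
  then show ?case
    using bounded_linear.continuous_on[OF assms(1)] by auto
next
  case (Suc n)
  from Suc.prems obtain f' where f': "\<And>p. (f has_derivative f' p) (at p)"
    "\<And>v. higher_diff_on n UNIV (\<lambda>p. f' p v)" by (rule higher_diff_on_SucE) blast
  show ?case
    by (rule higher_diff_on_SucI[OF bounded_linear.has_derivative[OF assms(1) f'(1)]])
      (use Suc.IH f' in blast)
qed

lemma higher_diff_on_add: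
  assumes "higher_diff_on n UNIV f" and "higher_diff_on n UNIV g"
  shows "higher_diff_on n UNIV (\<lambda>p. f p + g p)"
  using assms
proof (induction n arbitrary: f g)
  case 0
  then show ?case by (auto intro: continuous_intros)
next
  case (Suc n)
  from Suc.prems(1) obtain f' where f': "\<And>p. (f has_derivative f' p) (at p)"
    "\<And>v. higher_diff_on n UNIV (\<lambda>p. f' p v)" by (rule higher_diff_on_SucE) blast
  from Suc.prems(2) obtain g' where g': "\<And>p. (g has_derivative g' p) (at p)"
    "\<And>v. higher_diff_on n UNIV (\<lambda>p. g' p v)" by (rule higher_diff_on_SucE) blast
  show ?case
    by (rule higher_diff_on_SucI[OF has_derivative_add[OF f'(1) g'(1)]])
      (use Suc.IH f' g' in blast)
qed

lemma higher_diff_on_scaleR: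
  assumes "higher_diff_on n UNIV f" and "higher_diff_on n UNIV g"
  shows "higher_diff_on n UNIV (\<lambda>p. f p *\<^sub>R g p)"
  using assms
proof (induction n arbitrary: f g)
  case 0
  then show ?case by (auto intro: continuous_intros)
next
  case (Suc n)
  from Suc.prems(1) obtain f' where f': "\<And>p. (f has_derivative f' p) (at p)"
    "\<And>v. higher_diff_on n UNIV (\<lambda>p. f' p v)" by (rule higher_diff_on_SucE) blast
  from Suc.prems(2) obtain g' where g': "\<And>p. (g has_derivative g' p) (at p)"
    "\<And>v. higher_diff_on n UNIV (\<lambda>p. g' p v)" by (rule higher_diff_on_SucE) blast
  note f = higher_diff_on_Suc_D[OF Suc.prems(1)] and g = higher_diff_on_Suc_D[OF Suc.prems(2)]
  show ?case
    by (rule higher_diff_on_SucI[OF has_derivative_scaleR[OF f'(1) g'(1)]])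
      (intro higher_diff_on_add Suc.IH f g f'(2) g'(2))
qed

section \<open>Smoothness of all orders and its closure properties\<close>

definition smooth :: "('a::real_normed_vector \<Rightarrow> 'b::real_normed_vector) \<Rightarrow> bool" where
  "smooth f \<longleftrightarrow> (\<forall>n. higher_diff_on n UNIV f)"

named_theorems smooth_intros

lemma smooth_const [smooth_intros]: "smooth (\<lambda>p. c)"
  by (auto simp: smooth_def)

lemma smooth_add [smooth_intros]: "smooth f \<Longrightarrow> smooth g \<Longrightarrow> smooth (\<lambda>p. f p + g p)"
  by (simp add: smooth_def higher_diff_on_add)

lemma smooth_scaleR [smooth_intros]: "smooth f \<Longrightarrow> smooth g \<Longrightarrow> smooth (\<lambda>p. f p *\<^sub>R g p)"
  by (simp add: smooth_def higher_diff_on_scaleR)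

lemma smooth_mult [smooth_intros]:
  fixes f g :: "'a::real_normed_vector \<Rightarrow> real"
  shows "smooth f \<Longrightarrow> smooth g \<Longrightarrow> smooth (\<lambda>p. f p * g p)"
  using smooth_scaleR[of f g] by simp

lemma smooth_bounded_linear_compose:
  "bounded_linear g \<Longrightarrow> smooth f \<Longrightarrow> smooth (\<lambda>p. g (f p))"
  by (simp add: smooth_def higher_diff_on_bounded_linear)

lemma smooth_minus [smooth_intros]: "smooth f \<Longrightarrow> smooth (\<lambda>p. - f p)"
  by (rule smooth_bounded_linear_compose[OF bounded_linear_minus[OF bounded_linear_ident]])

lemma smooth_diff [smooth_intros]: "smooth f \<Longrightarrow> smooth g \<Longrightarrow> smooth (\<lambda>p. f p - g p)"
  using smooth_add[of f "\<lambda>p. - g p"] by (simp add: smooth_minus)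

lemma smooth_sum [smooth_intros]:
  "(\<And>i. i \<in> I \<Longrightarrow> smooth (f i)) \<Longrightarrow> smooth (\<lambda>p. \<Sum>i\<in>I. f i p)"
proof (induction I rule: infinite_finite_induct)
  case (insert x F)
  then show ?case by (auto intro!: smooth_add)
qed (auto intro: smooth_const)

lemma smooth_bounded_linear:
  assumes "bounded_linear g"
  shows "smooth g"
  unfolding smooth_def
proof
  fix n
  show "higher_diff_on n UNIV g"
  proof (cases n)
    case 0
    then show ?thesis using linear_continuous_on[OF assms] by simp
  next
    case (Suc m)
    show ?thesis
      unfolding Suc
      by (rule higher_diff_on_SucI[OF bounded_linear_imp_has_derivative[OF assms]]) auto
  qed
qed

lemma smooth_fst [smooth_intros]: "smooth fst"
  and smooth_snd [smooth_intros]: "smooth snd"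
  by (rule smooth_bounded_linear; rule bounded_linear_fst bounded_linear_snd)+

text \<open>The derivative is the same composite times that of \<open>f\<close>, so the induction
  hypothesis covers the composite itself.\<close>

lemma smooth_exp [smooth_intros]:
  fixes f :: "'a::real_normed_vector \<Rightarrow> real"
  assumes "smooth f"
  shows "smooth (\<lambda>p. exp (f p))"
  unfolding smooth_def
proof
  fix n
  show "higher_diff_on n UNIV (\<lambda>p. exp (f p))"
  proof (induction n)
    case 0
    have "higher_diff_on 0 UNIV f" using assms by (simp add: smooth_def del: higher_diff_on.simps)
    then show ?case by (auto intro: continuous_intros)
  next
    case (Suc n)
    have "higher_diff_on (Suc n) UNIV f" using assms unfolding smooth_def by blast
    then obtain f' where f': "\<And>p. (f has_derivative f' p) (at p)"
      "\<And>v. higher_diff_on n UNIV (\<lambda>p. f' p v)" by (rule higher_diff_on_SucE) blast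
    have "((\<lambda>p. exp (f p)) has_derivative (\<lambda>v. exp (f p) *\<^sub>R f' p v)) (at p)" for p
      by (auto intro!: derivative_eq_intros f'(1))
    from higher_diff_on_SucI[OF this higher_diff_on_scaleR[OF Suc f'(2)]] show ?case .
  qed
qed

lemma smooth_cosh [smooth_intros]:
  fixes f :: "'a::real_normed_vector \<Rightarrow> real"
  shows "smooth f \<Longrightarrow> smooth (\<lambda>p. cosh (f p))"
  unfolding cosh_field_def divide_inverse by (intro smooth_intros)

lemma smooth_sinh [smooth_intros]:
  fixes f :: "'a::real_normed_vector \<Rightarrow> real"
  shows "smooth f \<Longrightarrow> smooth (\<lambda>p. sinh (f p))"
  unfolding sinh_field_def divide_inverse by (intro smooth_intros)

text \<open>Each derivative involves the other function, hence a simultaneous induction.\<close>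

lemma smooth_sin_cos:
  fixes f :: "'a::real_normed_vector \<Rightarrow> real"
  assumes "smooth f"
  shows "smooth (\<lambda>p. sin (f p)) \<and> smooth (\<lambda>p. cos (f p))"
proof -
  have "higher_diff_on n UNIV (\<lambda>p. sin (f p)) \<and> higher_diff_on n UNIV (\<lambda>p. cos (f p))" for n
  proof (induction n)
    case 0
    have "higher_diff_on 0 UNIV f" using assms by (simp add: smooth_def del: higher_diff_on.simps)
    then show ?case by (auto intro: continuous_intros)
  next
    case (Suc n)
    have "higher_diff_on (Suc n) UNIV f" using assms unfolding smooth_def by blast
    then obtain f' where f': "\<And>p. (f has_derivative f' p) (at p)"
      "\<And>v. higher_diff_on n UNIV (\<lambda>p. f' p v)" by (rule higher_diff_on_SucE) blast
    have d: "((\<lambda>p. sin (f p)) has_derivative (\<lambda>v. cos (f p) *\<^sub>R f' p v)) (at p)"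
      "((\<lambda>p. cos (f p)) has_derivative (\<lambda>v. sin (f p) *\<^sub>R (- f' p v))) (at p)" for p
      by (auto intro!: derivative_eq_intros f'(1))
    have m: "higher_diff_on n UNIV (\<lambda>p. - f' p v)" for v
      by (rule higher_diff_on_bounded_linear[OF bounded_linear_minus[OF bounded_linear_ident] f'(2)])
    show ?case
      using higher_diff_on_SucI[OF d(1) higher_diff_on_scaleR[OF conjunct2[OF Suc] f'(2)]]
        higher_diff_on_SucI[OF d(2) higher_diff_on_scaleR[OF conjunct1[OF Suc] m]] by blast
  qed
  then show ?thesis by (simp add: smooth_def)
qed

lemmas smooth_sin [smooth_intros] = conjunct1[OF smooth_sin_cos]
  and smooth_cos [smooth_intros] = conjunct2[OF smooth_sin_cos]

text \<open>The derivative is -1/2 times the cube of the function times the derivative of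
  \<open>f\<close>, so the induction closes. The case of interest is the normalizing factor
  \<open>g\<close> below.\<close>

lemma smooth_inverse_sqrt [smooth_intros]:
  fixes f :: "'a::real_normed_vector \<Rightarrow> real"
  assumes "smooth f" and pos: "\<And>p. 0 < f p"
  shows "smooth (\<lambda>p. inverse (sqrt (f p)))"
  unfolding smooth_def
proof
  fix n
  let ?g = "\<lambda>p. inverse (sqrt (f p))"
  show "higher_diff_on n UNIV ?g"
  proof (induction n)
    case 0
    have "higher_diff_on 0 UNIV f" using assms by (simp add: smooth_def del: higher_diff_on.simps)
    then show ?case using pos by (auto intro!: continuous_intros simp: less_imp_neq[symmetric])
  next
    case (Suc n)
    have "higher_diff_on (Suc n) UNIV f" using assms unfolding smooth_def by blast
    then obtain f' where f': "\<And>p. (f has_derivative f' p) (at p)"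
      "\<And>v. higher_diff_on n UNIV (\<lambda>p. f' p v)" by (rule higher_diff_on_SucE) blast
    have "(?g has_derivative (\<lambda>v. (?g p *\<^sub>R ?g p *\<^sub>R ?g p) *\<^sub>R ((- 1 / 2) *\<^sub>R f' p v))) (at p)" for p
    proof -
      have "f p \<noteq> 0" using pos[of p] by simp
      then show ?thesis using pos[of p]
        by (auto intro!: derivative_eq_intros f'(1) simp: field_simps)
    qed
    then show ?case
      by (rule higher_diff_on_SucI)
        (intro higher_diff_on_scaleR Suc f'(2) higher_diff_on_const)
  qed
qed

section \<open>One Fourier mode\<close>

text \<open>
  Here \<open>a, b, c, d\<close>, \<open>\<alpha>, \<beta>, \<kappa>\<close>, \<open>u, s\<close> stand for \<open>ta, tb, tc, td\<close>, \<open>A, B, K\<close>, \<open>D, S\<close> below; the left-hand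
  side is the derivative of \<open>F\<close>, and the last two squares on the right are what the energy has in
  excess of the area.
\<close>

lemma mode_identity:
  fixes a b c d k l j u u' s s' \<alpha> \<beta> \<alpha>' \<beta>' \<kappa> :: real
  assumes ab: "a\<^sup>2 + b\<^sup>2 = 1" and cd: "c\<^sup>2 + d\<^sup>2 = 1"
    and \<alpha>: "\<alpha> = l * c * b - k * a * d" and \<beta>: "\<beta> = l * a * d - k * c * b"
    and \<kappa>: "\<kappa> = l * b * d + k * a * c"
    and \<alpha>': "\<alpha>' = l * (\<beta> * d * b - c * \<alpha> * a) - k * (\<alpha> * b * d - a * \<beta> * c)"
    and \<beta>': "\<beta>' = l * (\<alpha> * b * d - a * \<beta> * c) - k * (\<beta> * d * b - c * \<alpha> * a)"
  shows "u' * u' + u * ((l\<^sup>2 + j\<^sup>2) * u + 2 * l * j * s)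
      + s' * s' + s * ((l\<^sup>2 + j\<^sup>2) * s + 2 * l * j * u)
      - ((l * (\<alpha> * b * c + a * \<beta> * d) + \<alpha>' * a * b + \<alpha> * (\<alpha> * b * b - a * \<alpha> * a)) * u\<^sup>2
         + (l * a * c + \<alpha> * a * b) * (2 * u * u')
         + (l * (\<alpha> * b * c + a * \<beta> * d) + \<beta>' * c * d + \<beta> * (\<beta> * d * d - c * \<beta> * c)) * s\<^sup>2
         + (l * a * c + \<beta> * c * d) * (2 * s * s')
         + 2 * j * ((\<alpha> * b * c + a * \<beta> * d) * u * s + a * c * (u' * s + u * s')))
    = (b * u' - \<alpha> * a * u)\<^sup>2 + (d * s' - \<beta> * c * s)\<^sup>2 + (j * (b * u) + \<kappa> * (d * s))\<^sup>2
     + (j * (d * s) + \<kappa> * (b * u))\<^sup>2 - 2 * \<alpha>\<^sup>2 * (b * u)\<^sup>2 - 2 * \<beta>\<^sup>2 * (d * s)\<^sup>2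
     + (u' * a - (j * s + l * u) * c)\<^sup>2 + (s' * c - (j * u + l * s) * a)\<^sup>2" (is "?L = ?R")
proof -
  \<comment> \<open>Both sides are quadratic forms in \<open>u\<close>, \<open>u'\<close>,
    \<open>s\<close>, \<open>s'\<close>. The coefficients of \<open>u\<^sup>2\<close>,
    \<open>s\<^sup>2\<close> and \<open>u * s\<close> are the ones that use the structure
    equations.\<close>
  have uu: "l\<^sup>2 + j\<^sup>2 - (l * (\<alpha> * b * c + a * \<beta> * d) + \<alpha>' * a * b + \<alpha> * (\<alpha> * b * b - a * \<alpha> * a))
      = (\<alpha> * a)\<^sup>2 + j\<^sup>2 * b\<^sup>2 + \<kappa>\<^sup>2 * b\<^sup>2 - 2 * \<alpha>\<^sup>2 * b\<^sup>2 + l\<^sup>2 * c\<^sup>2 + j\<^sup>2 * a\<^sup>2"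
    using ab cd \<alpha> \<beta> \<alpha>' \<beta>' \<kappa> by algebra
  have ss: "l\<^sup>2 + j\<^sup>2 - (l * (\<alpha> * b * c + a * \<beta> * d) + \<beta>' * c * d + \<beta> * (\<beta> * d * d - c * \<beta> * c))
      = (\<beta> * c)\<^sup>2 + j\<^sup>2 * d\<^sup>2 + \<kappa>\<^sup>2 * d\<^sup>2 - 2 * \<beta>\<^sup>2 * d\<^sup>2 + l\<^sup>2 * a\<^sup>2 + j\<^sup>2 * c\<^sup>2"
    using ab cd \<alpha> \<beta> \<alpha>' \<beta>' \<kappa> by algebra
  have us: "4 * l * j - 2 * j * (\<alpha> * b * c + a * \<beta> * d)
      = 4 * j * \<kappa> * b * d + 2 * j * l * c\<^sup>2 + 2 * j * l * a\<^sup>2"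
    using ab cd \<alpha> \<beta> \<kappa> by algebra
  \<comment> \<open>The factors \<open>1\<close> are written out to be matched with
    \<open>a\<^sup>2 + b\<^sup>2\<close> and \<open>c\<^sup>2 + d\<^sup>2\<close> in the next
    line.\<close>
  have "?L = (l\<^sup>2 + j\<^sup>2 - (l * (\<alpha> * b * c + a * \<beta> * d) + \<alpha>' * a * b + \<alpha> * (\<alpha> * b * b - a * \<alpha> * a))) * u\<^sup>2
      + (l\<^sup>2 + j\<^sup>2 - (l * (\<alpha> * b * c + a * \<beta> * d) + \<beta>' * c * d + \<beta> * (\<beta> * d * d - c * \<beta> * c))) * s\<^sup>2
      + (4 * l * j - 2 * j * (\<alpha> * b * c + a * \<beta> * d)) * (u * s) + 1 * u'\<^sup>2 + 1 * s'\<^sup>2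
      - 2 * (l * a * c + \<alpha> * a * b) * u * u' - 2 * (l * a * c + \<beta> * c * d) * s * s' - 2 * j * a * c * (u' * s + u * s')"
    by (simp add: algebra_simps power2_eq_square)
  also have "\<dots> = ((\<alpha> * a)\<^sup>2 + j\<^sup>2 * b\<^sup>2 + \<kappa>\<^sup>2 * b\<^sup>2 - 2 * \<alpha>\<^sup>2 * b\<^sup>2 + l\<^sup>2 * c\<^sup>2 + j\<^sup>2 * a\<^sup>2) * u\<^sup>2
      + ((\<beta> * c)\<^sup>2 + j\<^sup>2 * d\<^sup>2 + \<kappa>\<^sup>2 * d\<^sup>2 - 2 * \<beta>\<^sup>2 * d\<^sup>2 + l\<^sup>2 * a\<^sup>2 + j\<^sup>2 * c\<^sup>2) * s\<^sup>2
      + (4 * j * \<kappa> * b * d + 2 * j * l * c\<^sup>2 + 2 * j * l * a\<^sup>2) * (u * s) + (a\<^sup>2 + b\<^sup>2) * u'\<^sup>2 + (c\<^sup>2 + d\<^sup>2) * s'\<^sup>2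
      - 2 * (l * a * c + \<alpha> * a * b) * u * u' - 2 * (l * a * c + \<beta> * c * d) * s * s' - 2 * j * a * c * (u' * s + u * s')"
    unfolding uu ss us ab cd ..
  also have "\<dots> = (b * u' - \<alpha> * a * u)\<^sup>2 + (d * s' - \<beta> * c * s)\<^sup>2 + (j * (b * u) + \<kappa> * (d * s))\<^sup>2
     + (j * (d * s) + \<kappa> * (b * u))\<^sup>2 - 2 * \<alpha>\<^sup>2 * (b * u)\<^sup>2 - 2 * \<beta>\<^sup>2 * (d * s)\<^sup>2
     + (u' * a - (j * s + l * u) * c)\<^sup>2 + (s' * c - (j * u + l * s) * a)\<^sup>2"
    by (simp add: algebra_simps power2_eq_square)
  finally show ?thesis .
qed

text \<open>Integrality of \<open>k\<close> and \<open>l\<close> enters only through the deck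
  transformation, so the local geometry and the estimate of one mode are done for real
  parameters.\<close>

locale fraser_sargent =
  fixes k l T :: real
  assumes l_pos: "0 < l" and l_less_k: "l < k" and T_pos: "0 < T"
    and T_eq: "k * tanh (k * T) = l * coth (l * T)"
begin

section \<open>Profile functions of the moving frame\<close>

text \<open>
  In the orthonormal frame \<open>F\<^sub>1 = (e\<^sup>i\<^sup>l\<^sup>\<theta>, 0)\<close>, \<open>F\<^sub>2 = (i e\<^sup>i\<^sup>l\<^sup>\<theta>, 0)\<close>, \<open>F\<^sub>3 = (0, e\<^sup>i\<^sup>k\<^sup>\<theta>)\<close>, \<open>F\<^sub>4 = (0, i e\<^sup>i\<^sup>k\<^sup>\<theta>)\<close> of \<open>\<complex>\<^sup>2\<close>, the unit
  tangent vectors of the surface are \<open>ta F\<^sub>1 + tb F\<^sub>3\<close> and \<open>tc F\<^sub>2 + td F\<^sub>4\<close>; the normal plane is spanned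
  by \<open>N\<^sub>1 = tb F\<^sub>1 - ta F\<^sub>3\<close> and \<open>N\<^sub>2 = td F\<^sub>2 - tc F\<^sub>4\<close>. Up to the conformal factor, the second fundamental
  form is given by \<open>A N\<^sub>1\<close> and \<open>B N\<^sub>2\<close>, and \<open>K\<close> is the normal connection form in the direction of \<open>\<theta>\<close>.
\<close>

definition R :: "real \<Rightarrow> real" where "R t = (cosh (l * t))\<^sup>2 + (sinh (k * t))\<^sup>2"

text \<open>Up to a constant, the reciprocal of the conformal factor \<open>lam\<close> introduced
  below.\<close>

definition g :: "real \<Rightarrow> real" where "g t = inverse (sqrt (R t))"

definition ta :: "real \<Rightarrow> real" where "ta t = cosh (l * t) * g t"
definition tb :: "real \<Rightarrow> real" where "tb t = sinh (k * t) * g t"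
definition tc :: "real \<Rightarrow> real" where "tc t = sinh (l * t) * g t"
definition td :: "real \<Rightarrow> real" where "td t = cosh (k * t) * g t"

definition A :: "real \<Rightarrow> real" where "A t = l * tc t * tb t - k * ta t * td t"
definition B :: "real \<Rightarrow> real" where "B t = l * ta t * td t - k * tc t * tb t"
definition K :: "real \<Rightarrow> real" where "K t = l * tb t * td t + k * ta t * tc t"

text \<open>By \<open>lam_end\<close> this is also the conformal factor along the boundary, whence
  its place in front of the boundary integrals.\<close>

definition \<mu> :: real where "\<mu> = k * tanh (k * T)"

lemma R_pos: "0 < R t"
  by (simp add: R_def add_pos_nonneg)

text \<open>Geometrically this is conformality: the two expressions are, up to a common factor, the
  squared lengths of the derivatives of the immersion in \<open>t\<close> and in \<theta>.\<close>

lemma R_alt: "R t = (sinh (l * t))\<^sup>2 + (cosh (k * t))\<^sup>2"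
  by (simp add: R_def cosh_square_eq)

lemma g_pos: "0 < g t"
  by (simp add: g_def R_pos)

lemma g_square: "(g t)\<^sup>2 * R t = 1"
  using R_pos[of t] by (simp add: g_def power_inverse)

lemma ta_tb: "(ta t)\<^sup>2 + (tb t)\<^sup>2 = 1"
  using g_square[of t] by (simp add: ta_def tb_def R_def algebra_simps power2_eq_square)

lemma tc_td: "(tc t)\<^sup>2 + (td t)\<^sup>2 = 1"
  using g_square[of t] by (simp add: tc_def td_def R_alt algebra_simps power2_eq_square)

lemma g_deriv:
  "(g has_real_derivative
      - (l * cosh (l * t) * sinh (l * t) + k * sinh (k * t) * cosh (k * t)) * (g t) ^ 3) (at t)"
proof -
  have "sqrt (R t) \<noteq> 0" using R_pos[of t] by simp
  then show ?thesis
    unfolding g_def R_def[abs_def] using R_pos[of t]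
    by (auto intro!: derivative_eq_intros simp: R_def[symmetric] field_simps power3_eq_cube)
qed

text \<open>The pairs \<open>(ta, tb)\<close> and \<open>(tc, td)\<close> are unit vectors, so their
  derivatives are multiples of \<open>(tb, - ta)\<close> and \<open>(td, - tc)\<close>; the
  multiples are \<open>A\<close> and \<open>B\<close>.\<close>

lemma frame_deriv:
  "(ta has_real_derivative A t * tb t) (at t)"
  "(tb has_real_derivative - A t * ta t) (at t)"
  "(tc has_real_derivative B t * td t) (at t)"
  "(td has_real_derivative - B t * tc t) (at t)"
proof -
  let ?G = "- (l * cosh (l * t) * sinh (l * t) + k * sinh (k * t) * cosh (k * t)) * (g t) ^ 3"
  have 1: "(g t) ^ 3 * ((cosh (l * t))\<^sup>2 + (sinh (k * t))\<^sup>2) = g t"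
    and 2: "(g t) ^ 3 * ((sinh (l * t))\<^sup>2 + (cosh (k * t))\<^sup>2) = g t"
    using g_square[of t] R_def[of t] R_alt[of t] by algebra+
  have "(ta has_real_derivative l * sinh (l * t) * g t + cosh (l * t) * ?G) (at t)"
    unfolding ta_def by (auto intro!: derivative_eq_intros g_deriv)
  also have "l * sinh (l * t) * g t + cosh (l * t) * ?G = A t * tb t"
    unfolding A_def ta_def tb_def tc_def td_def using arg_cong[OF 1, of "\<lambda>x. l * sinh (l * t) * x"]
    by (simp add: algebra_simps power2_eq_square power3_eq_cube)
  finally show "(ta has_real_derivative A t * tb t) (at t)" .
  have "(tb has_real_derivative k * cosh (k * t) * g t + sinh (k * t) * ?G) (at t)"
    unfolding tb_def by (auto intro!: derivative_eq_intros g_deriv)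
  also have "k * cosh (k * t) * g t + sinh (k * t) * ?G = - A t * ta t"
    unfolding A_def ta_def tb_def tc_def td_def using arg_cong[OF 1, of "\<lambda>x. k * cosh (k * t) * x"]
    by (simp add: algebra_simps power2_eq_square power3_eq_cube)
  finally show "(tb has_real_derivative - A t * ta t) (at t)" .
  have "(tc has_real_derivative l * cosh (l * t) * g t + sinh (l * t) * ?G) (at t)"
    unfolding tc_def by (auto intro!: derivative_eq_intros g_deriv)
  also have "l * cosh (l * t) * g t + sinh (l * t) * ?G = B t * td t"
    unfolding B_def ta_def tb_def tc_def td_def using arg_cong[OF 2, of "\<lambda>x. l * cosh (l * t) * x"]
    by (simp add: algebra_simps power2_eq_square power3_eq_cube)
  finally show "(tc has_real_derivative B t * td t) (at t)" .
  have "(td has_real_derivative k * sinh (k * t) * g t + cosh (k * t) * ?G) (at t)"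
    unfolding td_def by (auto intro!: derivative_eq_intros g_deriv)
  also have "k * sinh (k * t) * g t + cosh (k * t) * ?G = - B t * tc t"
    unfolding B_def ta_def tb_def tc_def td_def using arg_cong[OF 2, of "\<lambda>x. k * sinh (k * t) * x"]
    by (simp add: algebra_simps power2_eq_square power3_eq_cube)
  finally show "(td has_real_derivative - B t * tc t) (at t)" .
qed

lemma A_B_deriv:
  "(A has_real_derivative l * (B t * td t * tb t - tc t * A t * ta t)
     - k * (A t * tb t * td t - ta t * B t * tc t)) (at t)"
  "(B has_real_derivative l * (A t * tb t * td t - ta t * B t * tc t)
     - k * (B t * td t * tb t - tc t * A t * ta t)) (at t)"
proof -
  have "((\<lambda>t. l * tc t * tb t - k * ta t * td t) has_real_derivative
      l * (B t * td t * tb t - tc t * A t * ta t) - k * (A t * tb t * td t - ta t * B t * tc t)) (at t)"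
    by (auto intro!: derivative_eq_intros frame_deriv simp: algebra_simps)
  then show "(A has_real_derivative l * (B t * td t * tb t - tc t * A t * ta t)
      - k * (A t * tb t * td t - ta t * B t * tc t)) (at t)"
    by (simp only: A_def[abs_def, symmetric])
  have "((\<lambda>t. l * ta t * td t - k * tc t * tb t) has_real_derivative
      l * (A t * tb t * td t - ta t * B t * tc t) - k * (B t * td t * tb t - tc t * A t * ta t)) (at t)"
    by (auto intro!: derivative_eq_intros frame_deriv simp: algebra_simps)
  then show "(B has_real_derivative l * (A t * tb t * td t - ta t * B t * tc t)
     - k * (B t * td t * tb t - tc t * A t * ta t)) (at t)"
    by (simp only: B_def[abs_def, symmetric])
qed

text \<open>
  The field \<open>h\<^sub>1 = e\<^sup>i\<^sup>l\<^sup>\<theta> (D cas (-j \<theta>) + i S cas (j \<theta>))\<close> with \<open>cas = cos + sin\<close> is harmonic, with boundary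
  values \<open>D = 0\<close> and \<open>S = 1\<close>.
\<close>

definition S :: "real \<Rightarrow> real \<Rightarrow> real" where
  "S j t = (cosh ((l + j) * t) / cosh ((l + j) * T) + cosh ((l - j) * t) / cosh ((l - j) * T)) / 2"
definition D :: "real \<Rightarrow> real \<Rightarrow> real" where
  "D j t = (cosh ((l + j) * t) / cosh ((l + j) * T) - cosh ((l - j) * t) / cosh ((l - j) * T)) / 2"
definition S' :: "real \<Rightarrow> real \<Rightarrow> real" where
  "S' j t = ((l + j) * sinh ((l + j) * t) / cosh ((l + j) * T) +
             (l - j) * sinh ((l - j) * t) / cosh ((l - j) * T)) / 2"
definition D' :: "real \<Rightarrow> real \<Rightarrow> real" where
  "D' j t = ((l + j) * sinh ((l + j) * t) / cosh ((l + j) * T) -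
             (l - j) * sinh ((l - j) * t) / cosh ((l - j) * T)) / 2"

text \<open>The last two equations express harmonicity of the field: \<open>S + D\<close> and
  \<open>S - D\<close> are multiples of \<open>cosh ((l + j) * t)\<close> and
  \<open>cosh ((l - j) * t)\<close>, with eigenvalues \<open>(l + j)\<^sup>2\<close> and
  \<open>(l - j)\<^sup>2\<close>.\<close>

lemma S_D_deriv:
  "(S j has_real_derivative S' j t) (at t)"
  "(D j has_real_derivative D' j t) (at t)"
  "(S' j has_real_derivative (l\<^sup>2 + j\<^sup>2) * S j t + 2 * l * j * D j t) (at t)"
  "(D' j has_real_derivative (l\<^sup>2 + j\<^sup>2) * D j t + 2 * l * j * S j t) (at t)"
proof -
  have nz: "cosh ((l + j) * T) \<noteq> 0" "cosh ((l - j) * T) \<noteq> 0"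
    by (simp_all add: less_imp_neq[symmetric])
  show "(S j has_real_derivative S' j t) (at t)" "(D j has_real_derivative D' j t) (at t)"
    unfolding S_def D_def S'_def D'_def
    by (auto intro!: DERIV_cdivide DERIV_add DERIV_diff derivative_eq_intros)
  have "(S' j has_real_derivative ((l + j)\<^sup>2 * cosh ((l + j) * t) / cosh ((l + j) * T) +
             (l - j)\<^sup>2 * cosh ((l - j) * t) / cosh ((l - j) * T)) / 2) (at t)"
    unfolding S'_def
    by (auto intro!: DERIV_cdivide DERIV_add DERIV_diff derivative_eq_intros simp: power2_eq_square)
  moreover have "((l + j)\<^sup>2 * cosh ((l + j) * t) / cosh ((l + j) * T) +
      (l - j)\<^sup>2 * cosh ((l - j) * t) / cosh ((l - j) * T)) / 2
    = (l\<^sup>2 + j\<^sup>2) * S j t + 2 * l * j * D j t"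
    unfolding S_def D_def using nz by (simp add: power2_eq_square field_simps)
  ultimately show "(S' j has_real_derivative (l\<^sup>2 + j\<^sup>2) * S j t + 2 * l * j * D j t) (at t)"
    by simp
  have "(D' j has_real_derivative ((l + j)\<^sup>2 * cosh ((l + j) * t) / cosh ((l + j) * T) -
             (l - j)\<^sup>2 * cosh ((l - j) * t) / cosh ((l - j) * T)) / 2) (at t)"
    unfolding D'_def
    by (auto intro!: DERIV_cdivide DERIV_add DERIV_diff derivative_eq_intros simp: power2_eq_square)
  moreover have "((l + j)\<^sup>2 * cosh ((l + j) * t) / cosh ((l + j) * T) -
      (l - j)\<^sup>2 * cosh ((l - j) * t) / cosh ((l - j) * T)) / 2
    = (l\<^sup>2 + j\<^sup>2) * D j t + 2 * l * j * S j t"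
    unfolding S_def D_def using nz by (simp add: power2_eq_square field_simps)
  ultimately show "(D' j has_real_derivative (l\<^sup>2 + j\<^sup>2) * D j t + 2 * l * j * S j t) (at t)"
    by simp
qed

lemma S_D_end: "S j T = 1" "D j T = 0" "S j (- T) = 1" "D j (- T) = 0"
  by (simp_all add: S_def D_def less_imp_neq[symmetric])

lemma S'_odd: "S' j (- t) = - S' j t" "D' j (- t) = - D' j t"
  by (simp_all add: S'_def D'_def diff_divide_distrib add_divide_distrib)

lemma S_even: "S j (- t) = S j t" "D j (- t) = D j t"
  by (simp_all add: S_def D_def)

text \<open>\<open>\<xi>\<close> and \<open>\<eta>\<close> are the \<open>N\<^sub>1\<close>- and \<open>N\<^sub>2\<close>-amplitudes of the normal part of this field.\<close>

definition \<xi> :: "real \<Rightarrow> real \<Rightarrow> real" where "\<xi> j t = tb t * D j t"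
definition \<eta> :: "real \<Rightarrow> real \<Rightarrow> real" where "\<eta> j t = td t * S j t"
definition \<xi>' :: "real \<Rightarrow> real \<Rightarrow> real" where "\<xi>' j t = tb t * D' j t - A t * ta t * D j t"
definition \<eta>' :: "real \<Rightarrow> real \<Rightarrow> real" where "\<eta>' j t = td t * S' j t - B t * tc t * S j t"

lemma \<xi>_\<eta>_deriv:
  "(\<xi> j has_real_derivative \<xi>' j t) (at t)" "(\<eta> j has_real_derivative \<eta>' j t) (at t)"
  unfolding \<xi>_def \<eta>_def \<xi>'_def \<eta>'_def
  by (auto intro!: derivative_eq_intros frame_deriv S_D_deriv)

text \<open>The area integrand of mode \<open>j\<close>, integrated over \<theta> and divided by the
  period. The conformal factor has cancelled.\<close>

definition e :: "real \<Rightarrow> real \<Rightarrow> real" where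
  "e j t = (\<xi>' j t)\<^sup>2 + (\<eta>' j t)\<^sup>2 + (j * \<xi> j t + K t * \<eta> j t)\<^sup>2 + (j * \<eta> j t + K t * \<xi> j t)\<^sup>2
     - 2 * (A t)\<^sup>2 * (\<xi> j t)\<^sup>2 - 2 * (B t)\<^sup>2 * (\<eta> j t)\<^sup>2"

text \<open>
  The first two terms are a primitive of the energy density of \<open>h\<close>; the bracket is the flux that
  arises on passing from \<open>h\<close> to its normal part.
\<close>

definition F :: "real \<Rightarrow> real \<Rightarrow> real" where
  "F j t = D j t * D' j t + S j t * S' j t
     - ((l * ta t * tc t + A t * ta t * tb t) * (D j t)\<^sup>2
      + (l * ta t * tc t + B t * tc t * td t) * (S j t)\<^sup>2
      + 2 * j * ta t * tc t * D j t * S j t)"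

text \<open>With \<open>e\<^sub>1\<close>, \<open>e\<^sub>2\<close> the unit tangent vectors, the
  two squares are the amplitudes of \<open>h\<^sub>t \<bullet> e\<^sub>1 - h\<^sub>\<theta>
  \<bullet> e\<^sub>2\<close> and \<open>h\<^sub>t \<bullet> e\<^sub>2 + h\<^sub>\<theta> \<bullet>
  e\<^sub>1\<close>. They measure how far the deformation along \<open>h\<close> fails to be
  conformal to first order, and this is the excess of energy over area.\<close>

lemma F_deriv:
  "(F j has_real_derivative
      e j t + (D' j t * ta t - (j * S j t + l * D j t) * tc t)\<^sup>2
            + (S' j t * tc t - (j * D j t + l * S j t) * ta t)\<^sup>2) (at t)"
proof -
  define a b c d where "a = ta t" and "b = tb t" and "c = tc t" and "d = td t"
  define \<alpha> \<beta> where "\<alpha> = A t" and "\<beta> = B t"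
  define s s' u u' where "s = S j t" and "s' = S' j t" and "u = D j t" and "u' = D' j t"
  define \<alpha>' \<beta>' where "\<alpha>' = l * (\<beta> * d * b - c * \<alpha> * a) - k * (\<alpha> * b * d - a * \<beta> * c)"
    and "\<beta>' = l * (\<alpha> * b * d - a * \<beta> * c) - k * (\<beta> * d * b - c * \<alpha> * a)"
  have A': "(A has_real_derivative \<alpha>') (at t)" and B': "(B has_real_derivative \<beta>') (at t)"
    using A_B_deriv[of t]
    by (simp_all add: \<alpha>'_def \<beta>'_def a_def b_def c_def d_def \<alpha>_def \<beta>_def)
  let ?F' = "u' * u' + u * ((l\<^sup>2 + j\<^sup>2) * u + 2 * l * j * s)
      + s' * s' + s * ((l\<^sup>2 + j\<^sup>2) * s + 2 * l * j * u)
      - ((l * (\<alpha> * b * c + a * \<beta> * d) + \<alpha>' * a * b + \<alpha> * (\<alpha> * b * b - a * \<alpha> * a)) * u\<^sup>2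
         + (l * a * c + \<alpha> * a * b) * (2 * u * u')
         + (l * (\<alpha> * b * c + a * \<beta> * d) + \<beta>' * c * d + \<beta> * (\<beta> * d * d - c * \<beta> * c)) * s\<^sup>2
         + (l * a * c + \<beta> * c * d) * (2 * s * s')
         + 2 * j * ((\<alpha> * b * c + a * \<beta> * d) * u * s + a * c * (u' * s + u * s')))"
  have F': "(F j has_real_derivative ?F') (at t)"
    unfolding F_def
    by (rule derivative_eq_intros frame_deriv S_D_deriv A' B' refl)+
      (simp add: a_def b_def c_def d_def \<alpha>_def \<beta>_def s_def s'_def u_def u'_def algebra_simps power2_eq_square)
  have ab: "a\<^sup>2 + b\<^sup>2 = 1" and cd: "c\<^sup>2 + d\<^sup>2 = 1"
    using ta_tb[of t] tc_td[of t] by (simp_all add: a_def b_def c_def d_def)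
  have \<alpha>: "\<alpha> = l * c * b - k * a * d" and \<beta>: "\<beta> = l * a * d - k * c * b"
    by (simp_all add: \<alpha>_def \<beta>_def A_def B_def a_def b_def c_def d_def)
  define \<kappa> where "\<kappa> = l * b * d + k * a * c"
  have "?F' = (b * u' - \<alpha> * a * u)\<^sup>2 + (d * s' - \<beta> * c * s)\<^sup>2 + (j * (b * u) + \<kappa> * (d * s))\<^sup>2
     + (j * (d * s) + \<kappa> * (b * u))\<^sup>2 - 2 * \<alpha>\<^sup>2 * (b * u)\<^sup>2 - 2 * \<beta>\<^sup>2 * (d * s)\<^sup>2
     + (u' * a - (j * s + l * u) * c)\<^sup>2 + (s' * c - (j * u + l * s) * a)\<^sup>2"
    by (rule mode_identity[OF ab cd \<alpha> \<beta> \<kappa>_def \<alpha>'_def \<beta>'_def])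
  also have "\<dots> = e j t + (D' j t * ta t - (j * S j t + l * D j t) * tc t)\<^sup>2
            + (S' j t * tc t - (j * D j t + l * S j t) * ta t)\<^sup>2"
    by (simp add: e_def \<xi>_def \<eta>_def \<xi>'_def \<eta>'_def K_def a_def b_def c_def d_def \<alpha>_def \<beta>_def
        s_def s'_def u_def u'_def \<kappa>_def)
  finally show ?thesis using F' by simp
qed

text \<open>The free boundary condition: for the immersion \<open>u\<close> below it says that the
  \<open>t\<close>-derivative of \<open>u\<close> at \<open>t = T\<close> equals \<mu> times
  \<open>u\<close>.\<close>

lemma \<mu>_eq: "l * cosh (l * T) = \<mu> * sinh (l * T)" "k * sinh (k * T) = \<mu> * cosh (k * T)"
proof -
  have "sinh (l * T) \<noteq> 0" using l_pos T_pos by simp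
  then show "l * cosh (l * T) = \<mu> * sinh (l * T)"
    using T_eq by (simp add: \<mu>_def coth_def)
  have "cosh (k * T) \<noteq> 0" by (simp add: less_imp_neq[symmetric])
  then show "k * sinh (k * T) = \<mu> * cosh (k * T)"
    by (simp add: \<mu>_def tanh_def)
qed

lemma frame_end: "l * ta T = \<mu> * tc T" "k * tb T = \<mu> * td T"
  unfolding ta_def tb_def tc_def td_def using \<mu>_eq by (metis mult.assoc)+

lemma frame_parity: "g (- t) = g t" "ta (- t) = ta t" "tb (- t) = - tb t" "tc (- t) = - tc t" "td (- t) = td t"
  by (simp_all add: ta_def tb_def tc_def td_def g_def R_def)

lemma A_B_parity: "A (- t) = A t" "B (- t) = B t"
  by (simp_all add: A_def B_def frame_parity)

lemma F_end: "F j T = S' j T - \<mu> * (tc T)\<^sup>2" "F j (- T) = - F j T"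
proof -
  \<comment> \<open>Along a free boundary on the sphere the mixed term of the second fundamental
    form vanishes.\<close>
  have "B T = 0"
    using frame_end unfolding B_def by algebra
  moreover have "l * ta T * tc T = \<mu> * (tc T)\<^sup>2"
    using frame_end by algebra
  ultimately show "F j T = S' j T - \<mu> * (tc T)\<^sup>2"
    by (simp add: F_def S_D_end)
  show "F j (- T) = - F j T"
    by (simp add: F_def S_D_end S'_odd frame_parity A_B_parity)
qed

lemma \<mu>_pos: "0 < \<mu>"
  using l_pos l_less_k T_pos by (simp add: \<mu>_def)

lemma tanh_square_less: "(tanh x)\<^sup>2 < 1" for x :: real
  by (metis abs_square_less_1 abs_less_iff tanh_real_gt_neg1 tanh_real_lt_1 minus_less_iff)

lemma tanh_product: "tanh (l * T) * \<mu> = l"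
proof -
  have "tanh (l * T) \<noteq> 0" using l_pos T_pos by simp
  then show ?thesis
    using \<mu>_eq(1) by (auto simp: tanh_def field_simps)
qed

text \<open>With \<open>p = tanh (j * T)\<close> and \<open>q = tanh (l * T)\<close>, the addition
  theorem makes \<open>2 * S' j T\<close> a rational expression in \<open>p\<close> and
  \<open>q\<close>, and clearing the positive denominators leaves a multiple of
  \<open>j * p - \<mu>\<close>.\<close>

lemma S'_less: 
  assumes "\<bar>j\<bar> < k"
  shows "S' j T < \<mu>"
proof -
  define p q where "p = tanh (j * T)" and "q = tanh (l * T)"
  have q0: "0 < q" using l_pos T_pos by (simp add: q_def)
  have p2: "p\<^sup>2 < 1" and q2: "q\<^sup>2 < 1" by (simp_all add: p_def q_def tanh_square_less)
  have "(q * p)\<^sup>2 < 1\<^sup>2"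
    using mult_strict_mono[OF q2 p2] by (simp add: power_mult_distrib)
  then have pq: "\<bar>q * p\<bar> < 1"
    using abs_le_square_iff[of 1 "q * p"] by linarith
  \<comment> \<open>The function \<open>j * tanh (j * T)\<close> is even in \<open>j\<close> and
    increases with the absolute value of \<open>j\<close>; its value at \<open>k\<close> is
    \<mu>.\<close>
  have "j * p = \<bar>j\<bar> * tanh (\<bar>j\<bar> * T)"
    by (cases "j \<ge> 0") (auto simp: p_def)
  also have "\<dots> \<le> \<bar>j\<bar> * tanh (k * T)"
    using assms T_pos by (intro mult_left_mono) (auto simp: tanh_real_le_iff)
  also have "\<dots> < \<mu>"
    unfolding \<mu>_def using assms l_pos l_less_k T_pos by (intro mult_strict_right_mono) auto
  finally have jp: "j * p < \<mu>" .
  have lq: "\<mu> * q = l" using tanh_product by (simp add: q_def mult.commute)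
  have t1: "tanh ((l + j) * T) = (q + p) / (1 + q * p)"
    unfolding p_def q_def distrib_right by (rule tanh_add) (simp_all add: less_imp_neq[symmetric])
  have t2: "tanh ((l - j) * T) = (q - p) / (1 - q * p)"
    using tanh_add[of "l * T" "- (j * T)"]
    by (simp add: p_def q_def left_diff_distrib less_imp_neq[symmetric])
  have S': "2 * S' j T = (l + j) * tanh ((l + j) * T) + (l - j) * tanh ((l - j) * T)"
    by (simp add: S'_def tanh_def ac_simps)
  have n1: "0 < 1 + q * p" and n2: "0 < 1 - q * p" using pq by linarith+
  have "(2 * S' j T - 2 * \<mu>) * ((1 + q * p) * (1 - q * p)) =
      (l + j) * (q + p) * (1 - q * p) + (l - j) * (q - p) * (1 + q * p) - 2 * \<mu> * ((1 + q * p) * (1 - q * p))"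
  proof -
    define x y where "x = tanh ((l + j) * T)" and "y = tanh ((l - j) * T)"
    have "q + p = x * (1 + q * p)" "q - p = y * (1 - q * p)"
      using n1 n2 by (simp_all add: x_def y_def t1 t2)
    then show ?thesis
      unfolding S' x_def[symmetric] y_def[symmetric] by algebra
  qed
  \<comment> \<open>Substituting \<open>l = \<mu> * q\<close> makes the factor
    \<open>1 - q\<^sup>2\<close> split off.\<close>
  also have "\<dots> = 2 * (1 - q\<^sup>2) * (j * p - \<mu>)"
    unfolding lq[symmetric] by (simp add: algebra_simps power2_eq_square)
  also have "\<dots> < 0"
    using q2 jp by (simp add: mult_pos_neg)
  finally have "(2 * S' j T - 2 * \<mu>) * ((1 + q * p) * (1 - q * p)) < 0" .
  moreover have "0 \<le> (2 * S' j T - 2 * \<mu>) * ((1 + q * p) * (1 - q * p))" if "\<mu> \<le> S' j T"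
    using that n1 n2 by (intro mult_nonneg_nonneg) simp_all
  ultimately show ?thesis by linarith
qed

lemma e_continuous: "continuous_on X (e j)"
proof -
  have "continuous_on X f" if "\<And>t. (f has_real_derivative f' t) (at t)" for f f' :: "real \<Rightarrow> real"
    using that by (meson DERIV_isCont continuous_at_imp_continuous_on)
  note * = this[OF frame_deriv(1)] this[OF frame_deriv(2)] this[OF frame_deriv(3)] this[OF frame_deriv(4)]
    this[OF S_D_deriv(1)] this[OF S_D_deriv(2)] this[OF S_D_deriv(3)] this[OF S_D_deriv(4)]
  show ?thesis
    unfolding e_def[abs_def] \<xi>_def \<eta>_def \<xi>'_def \<eta>'_def A_def B_def K_def
    by (intro continuous_intros *)
qed

text \<open>Dropping the two squares in \<open>F_deriv\<close> bounds the integral by the boundary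
  values of \<open>F\<close>. As \<open>tc\<close> and \<open>td\<close> have squares summing to 1,
  the boundary terms then combine to \<open>2 * (S' j T - \<mu>)\<close>.\<close>

lemma e_integral_less:
  assumes "\<bar>j\<bar> < k"
  shows "integral {-T..T} (e j) - 2 * \<mu> * (td T)\<^sup>2 < 0"
proof -
  let ?q = "\<lambda>t. e j t + (D' j t * ta t - (j * S j t + l * D j t) * tc t)\<^sup>2
            + (S' j t * tc t - (j * D j t + l * S j t) * ta t)\<^sup>2"
  have "(?q has_integral (F j T - F j (- T))) {-T..T}"
    by (rule fundamental_theorem_of_calculus)
      (use T_pos F_deriv in \<open>auto simp: has_real_derivative_iff_has_vector_derivative[symmetric]
          intro: has_field_derivative_at_within\<close>)
  moreover have "(e j has_integral (integral {-T..T} (e j))) {-T..T}"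
    by (intro integrable_integral integrable_continuous_interval e_continuous)
  moreover have "e j t \<le> ?q t" for t
    by simp
  ultimately have "integral {-T..T} (e j) \<le> F j T - F j (- T)"
    using has_integral_le by blast
  also have "\<dots> = 2 * (S' j T - \<mu> * (tc T)\<^sup>2)"
    by (simp add: F_end)
  also have "\<dots> = 2 * S' j T - 2 * \<mu> + 2 * \<mu> * (td T)\<^sup>2"
    using tc_td[of T] by algebra
  finally show ?thesis using S'_less[OF assms] by simp
qed

end

section \<open>Geometry of the strip\<close>

text \<open>Even at a boundary point the strip contains a short segment in each coordinate
  direction, which determines the derivative.\<close>

lemma has_derivative_unique_on_strip:
  assumes "0 < T" and "p \<in> strip T"
    and "(X has_derivative X') (at p within strip T)"
    and "(X has_derivative X'') (at p within strip T)"
  shows "X' = X''"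
proof (rule frechet_derivative_unique_within[OF assms(3,4)])
  fix i :: "real \<times> real" and \<epsilon> :: real
  assume i: "i \<in> Basis" and \<epsilon>: "0 < \<epsilon>"
  obtain t \<theta> where p: "p = (t, \<theta>)" by (cases p)
  have t: "- T \<le> t" "t \<le> T" using assms(2) by (auto simp: p strip_def)
  \<comment> \<open>The sign points towards the line \<open>t = 0\<close>, and a length of at most
    \<open>T\<close> cannot overshoot the opposite boundary.\<close>
  define d where "d = (if t \<le> 0 then 1 else - 1) * min (\<epsilon> / 2) T"
  have "0 < \<bar>d\<bar>" "\<bar>d\<bar> < \<epsilon>" "p + d *\<^sub>R i \<in> strip T"
    using i \<epsilon> t \<open>0 < T\<close> by (auto simp: d_def p strip_def Basis_prod_def abs_mult min_def)
  then show "\<exists>d. 0 < \<bar>d\<bar> \<and> \<bar>d\<bar> < \<epsilon> \<and> p + d *\<^sub>R i \<in> strip T" by blast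
qed

text \<open>Fields such as \<open>tangent_frame\<close> have an explicit form only on the strip.
  This lets them be differentiated there through a formula that is differentiable in the
  plane.\<close>

lemma dir_deriv_eqI:
  assumes "0 < T" and "p \<in> strip T" and "(Y has_derivative X') (at p)"
    and "\<And>q. q \<in> strip T \<Longrightarrow> X q = Y q"
  shows "dir_deriv T X p v = X' v"
proof -
  have "(X has_derivative X') (at p within strip T)"
    by (rule has_derivative_transform[OF assms(2) _ has_derivative_at_withinI[OF assms(3)]])
      (simp add: assms(4))
  moreover from this have "(X has_derivative frechet_derivative X (at p within strip T)) (at p within strip T)"
    using frechet_derivative_works by (blast intro: differentiableI)
  ultimately have "frechet_derivative X (at p within strip T) = X'"
    using has_derivative_unique_on_strip[OF assms(1,2)] by blast
  then show ?thesis by (simp add: dir_deriv_def)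
qed

lemma sum_Basis_real_prod:
  fixes \<phi> :: "real \<times> real \<Rightarrow> 'a::comm_monoid_add"
  shows "(\<Sum>i\<in>Basis. \<phi> i) = \<phi> (1, 0) + \<phi> (0, 1)"
  by (simp add: Basis_prod_def add.commute)

lemma has_derivative_fst_compose:
  assumes "(f has_real_derivative f') (at (fst p))"
  shows "((\<lambda>p. f (fst p)) has_derivative (\<lambda>v. f' * fst v)) (at p)"
proof -
  have "((f \<circ> fst) has_derivative ((*) f' \<circ> fst)) (at p)"
    by (rule diff_chain_at[OF has_derivative_fst[OF has_derivative_ident]])
      (use assms in \<open>simp add: has_field_derivative_def\<close>)
  then show ?thesis by (simp add: o_def)
qed

context fraser_sargent
begin

section \<open>Coordinates in the rotating frame \<open>F\<^sub>1, ..., F\<^sub>4\<close>\<close>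

definition fr :: "real \<Rightarrow> real \<Rightarrow> real \<Rightarrow> real \<Rightarrow> real \<Rightarrow> real ^ 4" where
  "fr \<theta> a b c d =
     (a * cos (l * \<theta>) - b * sin (l * \<theta>)) *\<^sub>R axis 1 1 +
     (a * sin (l * \<theta>) + b * cos (l * \<theta>)) *\<^sub>R axis 2 1 +
     (c * cos (k * \<theta>) - d * sin (k * \<theta>)) *\<^sub>R axis 3 1 +
     (c * sin (k * \<theta>) + d * cos (k * \<theta>)) *\<^sub>R axis 4 1"

lemma fr_inner: "fr \<theta> a b c d \<bullet> fr \<theta> a' b' c' d' = a * a' + b * b' + c * c' + d * d'"
proof -
  have rot: "(x * C - y * S) * (x' * C - y' * S) + (x * S + y * C) * (x' * S + y' * C) = x * x' + y * y'"
    if "S\<^sup>2 + C\<^sup>2 = 1" for x y x' y' C S :: real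
    using that by algebra
  show ?thesis
    using rot[OF sin_cos_squared_add[of "l * \<theta>"], of a b a' b']
      rot[OF sin_cos_squared_add[of "k * \<theta>"], of c d c' d']
    by (simp add: fr_def inner_vec_def sum_4 axis_def)
qed

lemma fr_norm: "(norm (fr \<theta> a b c d))\<^sup>2 = a\<^sup>2 + b\<^sup>2 + c\<^sup>2 + d\<^sup>2"
  unfolding power2_norm_eq_inner fr_inner by (simp add: power2_eq_square)

lemma fr_scaleR: "x *\<^sub>R fr \<theta> a b c d = fr \<theta> (x * a) (x * b) (x * c) (x * d)"
  by (simp add: fr_def scaleR_add_right algebra_simps)

lemma fr_add: "fr \<theta> a b c d + fr \<theta> a' b' c' d' = fr \<theta> (a + a') (b + b') (c + c') (d + d')"
  by (simp add: fr_def algebra_simps)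

lemma fr_diff: "fr \<theta> a b c d - fr \<theta> a' b' c' d' = fr \<theta> (a - a') (b - b') (c - c') (d - d')"
  by (simp add: fr_def algebra_simps)

lemma fr_zero: "fr \<theta> 0 0 0 0 = 0"
  by (simp add: fr_def)

text \<open>The cross terms come from the rotation of the frame: \<open>F\<^sub>1\<close> and
  \<open>F\<^sub>2\<close> turn at rate \<open>l\<close>, \<open>F\<^sub>3\<close> and
  \<open>F\<^sub>4\<close> at rate \<open>k\<close>.\<close>

lemma fr_deriv:
  assumes "(a has_derivative a') (at p)" "(b has_derivative b') (at p)"
    "(c has_derivative c') (at p)" "(d has_derivative d') (at p)"
  shows "((\<lambda>p. fr (snd p) (a p) (b p) (c p) (d p)) has_derivative
     (\<lambda>v. fr (snd p) (a' v - l * b p * snd v) (b' v + l * a p * snd v)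
                     (c' v - k * d p * snd v) (d' v + k * c p * snd v))) (at p)"
  unfolding fr_def
  by (rule derivative_eq_intros assms refl)+ (simp add: algebra_simps)

lemma smooth_fr [smooth_intros]:
  assumes "smooth \<theta>" "smooth a" "smooth b" "smooth c" "smooth d"
  shows "smooth (\<lambda>p. fr (\<theta> p) (a p) (b p) (c p) (d p))"
  unfolding fr_def by (intro smooth_intros assms)

section \<open>The immersion, its conformal factor and its tangent frame\<close>

definition r :: real where
  "r = sqrt (k\<^sup>2 * (sinh (l * T))\<^sup>2 + l\<^sup>2 * (cosh (k * T))\<^sup>2)"

definition u :: "real \<times> real \<Rightarrow> real ^ 4" where
  "u p = fr (snd p) (k * sinh (l * fst p) / r) 0 (l * cosh (k * fst p) / r) 0"

definition lam :: "real \<Rightarrow> real" where "lam t = k * l / (r * g t)"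

lemma k_pos: "0 < k"
  using l_pos l_less_k by simp

lemma r_pos: "0 < r"
  using l_pos by (simp add: r_def add_nonneg_pos)

lemma lam_pos: "0 < lam t"
  using l_pos k_pos r_pos g_pos[of t] by (simp add: lam_def)

lemma lam_frame:
  "lam t * ta t = k * l * cosh (l * t) / r" "lam t * tb t = k * l * sinh (k * t) / r"
  "lam t * tc t = k * l * sinh (l * t) / r" "lam t * td t = k * l * cosh (k * t) / r"
  using g_pos[of t] by (simp_all add: lam_def ta_def tb_def tc_def td_def)

text \<open>On the boundary the \<open>t\<close>-derivative of \<open>u\<close> is \<mu> times
  \<open>u\<close> up to sign, and \<open>r\<close> is chosen so that \<open>u\<close> has length 1
  there.\<close>

lemma lam_end: "lam T = \<mu>" "lam (- T) = \<mu>"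
proof -
  have "(lam T)\<^sup>2 = (lam T * tc T)\<^sup>2 + (lam T * td T)\<^sup>2"
    using tc_td[of T] by algebra
  also have "\<dots> = (lam T * ta T)\<^sup>2 + (lam T * tb T)\<^sup>2"
    using tc_td[of T] ta_tb[of T] by algebra
  also have "\<dots> = (k * (l * cosh (l * T)))\<^sup>2 / r\<^sup>2 + (l * (k * sinh (k * T)))\<^sup>2 / r\<^sup>2"
    unfolding lam_frame by (simp add: power_divide mult_ac)
  also have "\<dots> = \<mu>\<^sup>2 * (k\<^sup>2 * (sinh (l * T))\<^sup>2 + l\<^sup>2 * (cosh (k * T))\<^sup>2) / r\<^sup>2"
    unfolding \<mu>_eq by (simp add: power_mult_distrib add_divide_distrib algebra_simps)
  also have "k\<^sup>2 * (sinh (l * T))\<^sup>2 + l\<^sup>2 * (cosh (k * T))\<^sup>2 = r\<^sup>2"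
    by (simp add: r_def)
  finally have "(lam T)\<^sup>2 = \<mu>\<^sup>2" using r_pos by simp
  then show "lam T = \<mu>" using lam_pos[of T] \<mu>_pos by simp
  then show "lam (- T) = \<mu>" by (simp add: lam_def frame_parity)
qed

lemma u_deriv:
  "(u has_derivative (\<lambda>v. fr (snd p) (lam (fst p) * ta (fst p) * fst v) (lam (fst p) * tc (fst p) * snd v)
     (lam (fst p) * tb (fst p) * fst v) (lam (fst p) * td (fst p) * snd v))) (at p)"
proof -
  have a: "((\<lambda>p. k * sinh (l * fst p) / r) has_derivative (\<lambda>v. k * l * cosh (l * fst p) / r * fst v)) (at p)"
    by (rule has_derivative_fst_compose) (use r_pos in \<open>auto intro!: derivative_eq_intros\<close>)
  have c: "((\<lambda>p. l * cosh (k * fst p) / r) has_derivative (\<lambda>v. k * l * sinh (k * fst p) / r * fst v)) (at p)"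
    by (rule has_derivative_fst_compose) (use r_pos in \<open>auto intro!: derivative_eq_intros\<close>)
  show ?thesis
    unfolding u_def[abs_def]
    by (rule has_derivative_eq_rhs[OF fr_deriv[OF a has_derivative_const c has_derivative_const]])
      (simp add: lam_frame, simp add: mult_ac)
qed

lemma dir_deriv_u:
  assumes "p \<in> strip T"
  shows "dir_deriv T u p v = fr (snd p) (lam (fst p) * ta (fst p) * fst v) (lam (fst p) * tc (fst p) * snd v)
     (lam (fst p) * tb (fst p) * fst v) (lam (fst p) * td (fst p) * snd v)"
  by (rule dir_deriv_eqI[OF T_pos assms u_deriv]) simp

lemma norm_dir_deriv_u:
  assumes "p \<in> strip T"
  shows "norm (dir_deriv T u p (1, 0)) = lam (fst p)" "norm (dir_deriv T u p (0, 1)) = lam (fst p)"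
proof -
  have "(norm (dir_deriv T u p (1, 0)))\<^sup>2 = (lam (fst p))\<^sup>2"
    by (simp add: dir_deriv_u[OF assms] fr_norm power_mult_distrib ta_tb flip: distrib_left)
  then show "norm (dir_deriv T u p (1, 0)) = lam (fst p)"
    using lam_pos[of "fst p"] by simp
  have "(norm (dir_deriv T u p (0, 1)))\<^sup>2 = (lam (fst p))\<^sup>2"
    by (simp add: dir_deriv_u[OF assms] fr_norm power_mult_distrib tc_td flip: distrib_left)
  then show "norm (dir_deriv T u p (0, 1)) = lam (fst p)"
    using lam_pos[of "fst p"] by simp
qed

lemma frame_field_u:
  assumes "p \<in> strip T"
  shows "frame_field T u (1, 0) p = (1 / lam (fst p), 0)" "frame_field T u (0, 1) p = (0, 1 / lam (fst p))"
  by (simp_all add: frame_field_def norm_dir_deriv_u[OF assms] divide_inverse)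

lemma tangent_frame_u:
  assumes "p \<in> strip T"
  shows "tangent_frame T u (1, 0) p = fr (snd p) (ta (fst p)) 0 (tb (fst p)) 0"
    "tangent_frame T u (0, 1) p = fr (snd p) 0 (tc (fst p)) 0 (td (fst p))"
  using lam_pos[of "fst p"]
  by (simp_all add: tangent_frame_def frame_field_u[OF assms] dir_deriv_u[OF assms])

lemma normal_part_u:
  assumes "p \<in> strip T" and "fst p = t"
  shows "normal_part T u p (fr (snd p) a b c d) =
    fr (snd p) (tb t * (tb t * a - ta t * c)) (td t * (td t * b - tc t * d))
      (- ta t * (tb t * a - ta t * c)) (- tc t * (td t * b - tc t * d))"
proof -
  have "a - (a * ta t + c * tb t) * ta t = tb t * (tb t * a - ta t * c)"
    "c - (a * ta t + c * tb t) * tb t = - ta t * (tb t * a - ta t * c)"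
    "b - (b * tc t + d * td t) * tc t = td t * (td t * b - tc t * d)"
    "d - (b * tc t + d * td t) * td t = - tc t * (td t * b - tc t * d)"
    using ta_tb[of t] tc_td[of t] by algebra+
  then show ?thesis
    using assms(2)
    by (simp add: normal_part_def sum_Basis_real_prod tangent_frame_u[OF assms(1)] fr_inner fr_scaleR
        fr_add fr_diff)
qed

section \<open>Normal frame \<open>N\<^sub>1, N\<^sub>2\<close>, second fundamental form and normal
  connection\<close>

definition nrm :: "real \<times> real \<Rightarrow> real \<Rightarrow> real \<Rightarrow> real ^ 4" where
  "nrm p x y = fr (snd p) (tb (fst p) * x) (td (fst p) * y) (- ta (fst p) * x) (- tc (fst p) * y)"

lemma normal_part_nrm:
  assumes "p \<in> strip T"
  shows "normal_part T u p (fr (snd p) a b c d) =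
    nrm p (tb (fst p) * a - ta (fst p) * c) (td (fst p) * b - tc (fst p) * d)"
  by (simp add: normal_part_u[OF assms refl] nrm_def)

lemma nrm_inner: "nrm p x y \<bullet> nrm p x' y' = x * x' + y * y'"
  using ta_tb[of "fst p"] tc_td[of "fst p"] unfolding nrm_def fr_inner by algebra

lemma nrm_norm: "(norm (nrm p x y))\<^sup>2 = x\<^sup>2 + y\<^sup>2"
  unfolding power2_norm_eq_inner nrm_inner by (simp add: power2_eq_square)

lemma frame_deriv_fst:
  "((\<lambda>p. ta (fst p)) has_derivative (\<lambda>v. A (fst p) * tb (fst p) * fst v)) (at p)"
  "((\<lambda>p. tb (fst p)) has_derivative (\<lambda>v. - A (fst p) * ta (fst p) * fst v)) (at p)"
  "((\<lambda>p. tc (fst p)) has_derivative (\<lambda>v. B (fst p) * td (fst p) * fst v)) (at p)"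
  "((\<lambda>p. td (fst p)) has_derivative (\<lambda>v. - B (fst p) * tc (fst p) * fst v)) (at p)"
  by (rule has_derivative_fst_compose frame_deriv)+

lemma dir_deriv_tangent_frame:
  assumes "p \<in> strip T" and "fst p = t"
  shows "dir_deriv T (tangent_frame T u (1, 0)) p v =
      fr (snd p) (A t * tb t * fst v) (l * ta t * snd v) (- A t * ta t * fst v) (k * tb t * snd v)"
    "dir_deriv T (tangent_frame T u (0, 1)) p v =
      fr (snd p) (- l * tc t * snd v) (B t * td t * fst v) (- k * td t * snd v) (- B t * tc t * fst v)"
proof -
  show "dir_deriv T (tangent_frame T u (1, 0)) p v =
      fr (snd p) (A t * tb t * fst v) (l * ta t * snd v) (- A t * ta t * fst v) (k * tb t * snd v)"
    using dir_deriv_eqI[OF T_pos assms(1) fr_deriv[OF frame_deriv_fst(1) has_derivative_const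
          frame_deriv_fst(2) has_derivative_const] tangent_frame_u(1)] assms(2)
    by simp
  show "dir_deriv T (tangent_frame T u (0, 1)) p v =
      fr (snd p) (- l * tc t * snd v) (B t * td t * fst v) (- k * td t * snd v) (- B t * tc t * fst v)"
    using dir_deriv_eqI[OF T_pos assms(1) fr_deriv[OF has_derivative_const frame_deriv_fst(3)
          has_derivative_const frame_deriv_fst(4)] tangent_frame_u(2)] assms(2)
    by simp
qed

text \<open>The opposite diagonal entries are the minimality of the surface.\<close>

lemma second_fund_form_u:
  assumes "p \<in> strip T" and "fst p = t"
  shows "second_fund_form T u (1, 0) (1, 0) p = nrm p (A t / lam t) 0"
    "second_fund_form T u (0, 1) (1, 0) p = nrm p 0 (B t / lam t)"
    "second_fund_form T u (1, 0) (0, 1) p = nrm p 0 (B t / lam t)"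
    "second_fund_form T u (0, 1) (0, 1) p = nrm p (- A t / lam t) 0"
proof -
  have eq: "tb t * (A t * tb t / x) + ta t * (A t * ta t / x) = A t / x"
    "td t * (B t * td t / x) + tc t * (B t * tc t / x) = B t / x" for x
    using ta_tb[of t] tc_td[of t] by (simp_all add: add_divide_distrib[symmetric]) algebra+
  show "second_fund_form T u (1, 0) (1, 0) p = nrm p (A t / lam t) 0"
    "second_fund_form T u (0, 1) (1, 0) p = nrm p 0 (B t / lam t)"
    "second_fund_form T u (1, 0) (0, 1) p = nrm p 0 (B t / lam t)"
    "second_fund_form T u (0, 1) (0, 1) p = nrm p (- A t / lam t) 0"
    using assms eq
    by (simp_all add: second_fund_form_def frame_field_u dir_deriv_tangent_frame normal_part_nrm)
      (simp_all add: A_def B_def diff_divide_distrib mult_ac)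
qed

lemma simons_op_u:
  assumes "p \<in> strip T" and "fst p = t"
  shows "simons_op T u p (nrm p x y) \<bullet> nrm p x y = (2 * (A t)\<^sup>2 * x\<^sup>2 + 2 * (B t)\<^sup>2 * y\<^sup>2) / (lam t)\<^sup>2"
  using lam_pos[of t]
  unfolding simons_op_def sum_Basis_real_prod second_fund_form_u[OF assms] inner_add_left
    inner_scaleR_left nrm_inner
  by (simp add: field_simps power2_eq_square)

lemma area_density_u:
  assumes "p \<in> strip T" and "fst p = t"
  shows "area_density T u p = (lam t)\<^sup>2"
proof -
  have *: "dir_deriv T u p (1, 0) \<bullet> dir_deriv T u p (0, 1) = 0"
    by (simp add: dir_deriv_u[OF assms(1)] fr_inner)
  show ?thesis
    unfolding area_density_def Let_def norm_dir_deriv_u[OF assms(1)] assms(2) *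
    by (rule real_sqrt_unique) (simp_all add: power2_eq_square)
qed

text \<open>In the direction of \<open>t\<close> the derivatives of \<open>N\<^sub>1\<close> and
  \<open>N\<^sub>2\<close> are tangential; in the direction of \<theta> the normal frame also
  rotates in the normal plane, at rate \<open>K\<close>.\<close>

lemma dir_deriv_section:
  assumes p: "p \<in> strip T" and t: "fst p = t"
    and x: "(x has_derivative x') (at p)" and y: "(y has_derivative y') (at p)"
    and X: "\<And>q. q \<in> strip T \<Longrightarrow> X q = nrm q (x q) (y q)"
  shows "normal_part T u p (dir_deriv T X p v) =
    nrm p (x' v - K t * y p * snd v) (y' v + K t * x p * snd v)"
proof -
  have "dir_deriv T X p v = fr (snd p)
      (- A t * ta t * fst v * x p + tb t * x' v - l * (td t * y p) * snd v)
      (- B t * tc t * fst v * y p + td t * y' v + l * (tb t * x p) * snd v)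
      (- (A t * tb t * fst v * x p) - ta t * x' v + k * (tc t * y p) * snd v)
      (- tc t * y' v - k * (ta t * x p) * snd v - B t * td t * fst v * y p)"
    using dir_deriv_eqI[OF T_pos p fr_deriv[OF has_derivative_mult[OF frame_deriv_fst(2) x]
          has_derivative_mult[OF frame_deriv_fst(4) y]
          has_derivative_mult[OF has_derivative_minus[OF frame_deriv_fst(1)] x]
          has_derivative_mult[OF has_derivative_minus[OF frame_deriv_fst(3)] y]]
        X[unfolded nrm_def], of v] t
    by (simp add: algebra_simps)
  note D = this
  have 1: "tb t * (- A t * ta t * fst v * x p + tb t * x' v - l * (td t * y p) * snd v)
        - ta t * (- (A t * tb t * fst v * x p) - ta t * x' v + k * (tc t * y p) * snd v)
      = ((ta t)\<^sup>2 + (tb t)\<^sup>2) * x' v - K t * y p * snd v"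
    by (simp add: K_def algebra_simps power2_eq_square)
  have 2: "td t * (- B t * tc t * fst v * y p + td t * y' v + l * (tb t * x p) * snd v)
        - tc t * (- tc t * y' v - k * (ta t * x p) * snd v - B t * td t * fst v * y p)
      = ((tc t)\<^sup>2 + (td t)\<^sup>2) * y' v + K t * x p * snd v"
    by (simp add: K_def algebra_simps power2_eq_square)
  show ?thesis
    unfolding D normal_part_nrm[OF p] t 1 2 ta_tb tc_td mult_1 ..
qed

lemma normal_deriv_section:
  assumes p: "p \<in> strip T" and t: "fst p = t"
    and x: "(x has_derivative x') (at p)" and y: "(y has_derivative y') (at p)"
    and X: "\<And>q. q \<in> strip T \<Longrightarrow> X q = nrm q (x q) (y q)"
  shows "(\<Sum>i\<in>Basis. (norm (normal_deriv T u X i p))\<^sup>2) =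
    ((x' (1, 0))\<^sup>2 + (y' (1, 0))\<^sup>2 + (x' (0, 1) - K t * y p)\<^sup>2 + (y' (0, 1) + K t * x p)\<^sup>2) / (lam t)\<^sup>2"
proof -
  have "x' (1 / lam t, 0) = x' ((1 / lam t) *\<^sub>R (1, 0))" "x' (0, 1 / lam t) = x' ((1 / lam t) *\<^sub>R (0, 1))"
    "y' (1 / lam t, 0) = y' ((1 / lam t) *\<^sub>R (1, 0))" "y' (0, 1 / lam t) = y' ((1 / lam t) *\<^sub>R (0, 1))"
    by simp_all
  then have *: "x' (1 / lam t, 0) = x' (1, 0) / lam t" "x' (0, 1 / lam t) = x' (0, 1) / lam t"
    "y' (1 / lam t, 0) = y' (1, 0) / lam t" "y' (0, 1 / lam t) = y' (0, 1) / lam t"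
    by (simp_all only: linear_scale[OF has_derivative_linear[OF x]] linear_scale[OF has_derivative_linear[OF y]]) simp_all
  have "normal_part T u p (dir_deriv T X p v) =
      nrm p (x' v - K t * y p * snd v) (y' v + K t * x p * snd v)" for v
    by (rule dir_deriv_section[OF p t x y]) (rule X)
  note comp = this[of "(1 / lam t, 0)"] this[of "(0, 1 / lam t)"]
  show ?thesis
    unfolding sum_Basis_real_prod normal_deriv_def frame_field_u[OF p] t comp nrm_norm * fst_conv snd_conv
    using lam_pos[of t] by (simp add: field_simps power2_eq_square)
qed

text \<open>The factor \<open>(lam t)\<^sup>2\<close> of the area density cancels against the unit
  frame and the second fundamental form, as expected from conformal invariance in dimension two.
  Only the boundary length element leaves a factor, \<mu>.\<close>

lemma second_variation_section:
  assumes "0 < P"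
    and x: "\<And>p. (x has_derivative x' p) (at p)" and y: "\<And>p. (y has_derivative y' p) (at p)"
    and X: "\<And>q. q \<in> strip T \<Longrightarrow> X q = nrm q (x q) (y q)"
  shows "second_variation T u P X =
    integral ({-T..T} \<times> {0..P}) (\<lambda>p. (x' p (1, 0))\<^sup>2 + (y' p (1, 0))\<^sup>2
      + (x' p (0, 1) - K (fst p) * y p)\<^sup>2 + (y' p (0, 1) + K (fst p) * x p)\<^sup>2
      - 2 * (A (fst p))\<^sup>2 * (x p)\<^sup>2 - 2 * (B (fst p))\<^sup>2 * (y p)\<^sup>2)
    - \<mu> * (integral {0..P} (\<lambda>\<theta>. (x (- T, \<theta>))\<^sup>2 + (y (- T, \<theta>))\<^sup>2)
         + integral {0..P} (\<lambda>\<theta>. (x (T, \<theta>))\<^sup>2 + (y (T, \<theta>))\<^sup>2))"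
proof -
  have strip: "p \<in> strip T" if "p \<in> {-T..T} \<times> {0..P}" for p
    using that by (auto simp: strip_def)
  have dens: "((\<Sum>i\<in>Basis. (norm (normal_deriv T u X i p))\<^sup>2) - simons_op T u p (X p) \<bullet> X p) * area_density T u p
    = (x' p (1, 0))\<^sup>2 + (y' p (1, 0))\<^sup>2
      + (x' p (0, 1) - K (fst p) * y p)\<^sup>2 + (y' p (0, 1) + K (fst p) * x p)\<^sup>2
      - 2 * (A (fst p))\<^sup>2 * (x p)\<^sup>2 - 2 * (B (fst p))\<^sup>2 * (y p)\<^sup>2" if "p \<in> {-T..T} \<times> {0..P}" for p
    using lam_pos[of "fst p"]
    by (simp add: normal_deriv_section[OF strip[OF that] refl x y X] X[OF strip[OF that]]
        simons_op_u[OF strip[OF that] refl] area_density_u[OF strip[OF that] refl] field_simps)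
  have bd: "(norm (X (\<tau>, \<theta>)))\<^sup>2 * norm (dir_deriv T u (\<tau>, \<theta>) (0, 1))
      = \<mu> * ((x (\<tau>, \<theta>))\<^sup>2 + (y (\<tau>, \<theta>))\<^sup>2)" if "\<tau> \<in> {-T, T}" for \<tau> \<theta>
  proof -
    have "(\<tau>, \<theta>) \<in> strip T" using that T_pos by (auto simp: strip_def)
    then show ?thesis
      using that lam_end by (auto simp: X nrm_norm norm_dir_deriv_u)
  qed
  have "(\<Sum>\<tau>\<in>{-T, T}. integral {0..P}
         (\<lambda>\<theta>. (norm (X (\<tau>, \<theta>)))\<^sup>2 * norm (dir_deriv T u (\<tau>, \<theta>) (0, 1))))
    = (\<Sum>\<tau>\<in>{-T, T}. \<mu> * integral {0..P} (\<lambda>\<theta>. (x (\<tau>, \<theta>))\<^sup>2 + (y (\<tau>, \<theta>))\<^sup>2))"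
    by (intro sum.cong refl) (simp only: bd integral_mult_right)
  also have "\<dots> = \<mu> * (integral {0..P} (\<lambda>\<theta>. (x (- T, \<theta>))\<^sup>2 + (y (- T, \<theta>))\<^sup>2)
         + integral {0..P} (\<lambda>\<theta>. (x (T, \<theta>))\<^sup>2 + (y (T, \<theta>))\<^sup>2))"
    using T_pos by (subst sum.insert) (auto simp: algebra_simps)
  finally show ?thesis
    unfolding second_variation_def using Henstock_Kurzweil_Integration.integral_cong[OF dens] by simp
qed

end

section \<open>Fourier expansion\<close>

text \<open>
  The functions \<open>cas (j \<theta>)\<close>, \<open>j \<in> \<int>\<close>, form a real orthogonal basis all of whose members have the same
  norm, so that a mode is indexed by a single integer without a special case for \<open>j = 0\<close>.
\<close>

definition cas :: "real \<Rightarrow> real" where "cas x = cos x + sin x"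

lemma continuous_on_cas [continuous_intros]:
  fixes f :: "'a::t2_space \<Rightarrow> real"
  shows "continuous_on X f \<Longrightarrow> continuous_on X (\<lambda>x. cas (f x))"
  unfolding cas_def by (intro continuous_intros)

lemma smooth_cas [smooth_intros]: "smooth f \<Longrightarrow> smooth (\<lambda>p. cas (f p))"
  unfolding cas_def by (intro smooth_intros)

text \<open>The product is \<open>cos ((i - j) * \<theta>) + sin ((i + j) * \<theta>)\<close>. Only
  \<open>i - j\<close> and \<open>i + j\<close> have to fit the period, which admits functions
  changing sign under translation by \<open>P\<close>.\<close>

lemma has_integral_cas_cas:
  assumes "0 < P" and diff: "(i - j) * P = 2 * pi * of_int a" and sum: "(i + j) * P = 2 * pi * of_int b"
  shows "((\<lambda>\<theta>. cas (i * \<theta>) * cas (j * \<theta>)) has_integral (if i = j then P else 0)) {0..P}"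
proof -
  have 1: "((\<lambda>\<theta>. cos ((i - j) * \<theta>)) has_integral (if i = j then P else 0)) {0..P}"
  proof (cases "i = j")
    case True
    then show ?thesis using has_integral_const_real[of "1::real" 0 P] assms(1) by simp
  next
    case False
    have "((\<lambda>\<theta>. cos ((i - j) * \<theta>)) has_integral (sin ((i - j) * P) / (i - j) - sin ((i - j) * 0) / (i - j))) {0..P}"
      by (rule fundamental_theorem_of_calculus)
        (use assms(1) False in \<open>auto intro!: derivative_eq_intros
            simp: has_real_derivative_iff_has_vector_derivative[symmetric]\<close>)
    then show ?thesis using False by (simp add: diff sin_integer_2pi)
  qed
  have 2: "((\<lambda>\<theta>. sin ((i + j) * \<theta>)) has_integral 0) {0..P}"
  proof (cases "i + j = 0")
    case True
    then show ?thesis by simp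
  next
    case False
    have "((\<lambda>\<theta>. sin ((i + j) * \<theta>)) has_integral (- cos ((i + j) * P) / (i + j) - (- cos ((i + j) * 0) / (i + j)))) {0..P}"
      by (rule fundamental_theorem_of_calculus)
        (use assms(1) False in \<open>auto intro!: derivative_eq_intros
            simp: has_real_derivative_iff_has_vector_derivative[symmetric]\<close>)
    then show ?thesis by (simp add: sum cos_integer_2pi)
  qed
  have "cas (i * \<theta>) * cas (j * \<theta>) = cos ((i - j) * \<theta>) + sin ((i + j) * \<theta>)" for \<theta>
    by (simp add: cas_def left_diff_distrib distrib_right cos_diff sin_add algebra_simps)
  then show ?thesis
    using has_integral_add[OF 1 2] by simp
qed

lemma parseval:
  fixes \<phi> :: "'i \<Rightarrow> real \<Rightarrow> real"
  assumes "finite J"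
    and "\<And>i j. i \<in> J \<Longrightarrow> j \<in> J \<Longrightarrow> ((\<lambda>\<theta>. \<phi> i \<theta> * \<phi> j \<theta>) has_integral (if i = j then P else 0)) I"
  shows "((\<lambda>\<theta>. (\<Sum>j\<in>J. c j * \<phi> j \<theta>)\<^sup>2) has_integral P * (\<Sum>j\<in>J. (c j)\<^sup>2)) I"
proof -
  have "((\<lambda>\<theta>. \<Sum>i\<in>J. \<Sum>j\<in>J. c i * c j * (\<phi> i \<theta> * \<phi> j \<theta>)) has_integral
      (\<Sum>i\<in>J. \<Sum>j\<in>J. c i * c j * (if i = j then P else 0))) I"
    using assms by (intro has_integral_sum has_integral_mult_right) auto
  also have "(\<lambda>\<theta>. \<Sum>i\<in>J. \<Sum>j\<in>J. c i * c j * (\<phi> i \<theta> * \<phi> j \<theta>)) = (\<lambda>\<theta>. (\<Sum>j\<in>J. c j * \<phi> j \<theta>)\<^sup>2)"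
    by (simp add: power2_eq_square sum_product mult_ac)
  also have "(\<Sum>i\<in>J. \<Sum>j\<in>J. c i * c j * (if i = j then P else 0)) = P * (\<Sum>j\<in>J. (c j)\<^sup>2)"
    using assms(1) by (simp add: power2_eq_square sum_distrib_left mult_ac if_distrib[where f = "\<lambda>x. _ * x"] cong: if_cong)
  finally show ?thesis .
qed

text \<open>\<open>J_period\<close> is what orthogonality over one fundamental domain requires. It
  holds for all integers if \<open>P = 2 * pi\<close>, and for integers of equal parity if
  \<open>P = pi\<close>.\<close>

locale fraser_sargent_modes = fraser_sargent +
  fixes J :: "int set" and P :: real
  assumes finite_J: "finite J" and P_pos: "0 < P"
    and J_less: "\<And>j. j \<in> J \<Longrightarrow> \<bar>of_int j\<bar> < k"
    and J_period: "\<And>i j. i \<in> J \<Longrightarrow> j \<in> J \<Longrightarrow>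
       (\<exists>a. of_int (i - j) * P = 2 * pi * of_int a) \<and> (\<exists>b. of_int (i + j) * P = 2 * pi * of_int b)"
begin

text \<open>The derivative of \<open>cas\<close> at \<open>z\<close> is \<open>cas (- z)\<close>.
  Reflecting the argument here but not in \<open>y\<close> makes each component of the normal
  derivative an expansion in a single orthogonal family.\<close>

definition x :: "(int \<Rightarrow> real) \<Rightarrow> real \<times> real \<Rightarrow> real" where
  "x \<gamma> p = (\<Sum>j\<in>J. \<gamma> j * \<xi> (of_int j) (fst p) * cas (- (of_int j * snd p)))"

definition y :: "(int \<Rightarrow> real) \<Rightarrow> real \<times> real \<Rightarrow> real" where
  "y \<gamma> p = (\<Sum>j\<in>J. \<gamma> j * \<eta> (of_int j) (fst p) * cas (of_int j * snd p))"

definition mode_section :: "(int \<Rightarrow> real) \<Rightarrow> real \<times> real \<Rightarrow> real ^ 4" where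
  "mode_section \<gamma> p = (if p \<in> strip T then nrm p (x \<gamma> p) (y \<gamma> p) else 0)"

lemma x_deriv:
  "(x \<gamma> has_derivative (\<lambda>v. (\<Sum>j\<in>J. \<gamma> j * \<xi>' (of_int j) (fst p) * cas (- (of_int j * snd p))) * fst v
      - (\<Sum>j\<in>J. \<gamma> j * (of_int j * \<xi> (of_int j) (fst p)) * cas (of_int j * snd p)) * snd v)) (at p)"
proof -
  have 1: "((\<lambda>p. \<xi> j (fst p)) has_derivative (\<lambda>v. \<xi>' j (fst p) * fst v)) (at p)" for j
    by (rule has_derivative_fst_compose \<xi>_\<eta>_deriv)+
  have 2: "((\<lambda>p. cas (- (n * snd p))) has_derivative (\<lambda>v. - n * cas (n * snd p) * snd v)) (at p)" for n
    unfolding cas_def by (auto intro!: derivative_eq_intros simp: algebra_simps)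
  show ?thesis
    unfolding x_def
    by (rule has_derivative_eq_rhs[OF has_derivative_sum[OF has_derivative_mult[OF has_derivative_mult_right[OF 1] 2]]])
      (simp only: sum_distrib_right sum_subtractf[symmetric], intro ext sum.cong refl, simp add: algebra_simps)
qed

lemma y_deriv:
  "(y \<gamma> has_derivative (\<lambda>v. (\<Sum>j\<in>J. \<gamma> j * \<eta>' (of_int j) (fst p) * cas (of_int j * snd p)) * fst v
      + (\<Sum>j\<in>J. \<gamma> j * (of_int j * \<eta> (of_int j) (fst p)) * cas (- (of_int j * snd p))) * snd v)) (at p)"
proof -
  have 1: "((\<lambda>p. \<eta> j (fst p)) has_derivative (\<lambda>v. \<eta>' j (fst p) * fst v)) (at p)" for j
    by (rule has_derivative_fst_compose \<xi>_\<eta>_deriv)+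
  have 2: "((\<lambda>p. cas (n * snd p)) has_derivative (\<lambda>v. n * cas (- (n * snd p)) * snd v)) (at p)" for n
    unfolding cas_def by (auto intro!: derivative_eq_intros simp: algebra_simps)
  show ?thesis
    unfolding y_def
    by (rule has_derivative_eq_rhs[OF has_derivative_sum[OF has_derivative_mult[OF has_derivative_mult_right[OF 1] 2]]])
      (simp only: sum_distrib_right sum.distrib[symmetric], intro ext sum.cong refl, simp add: algebra_simps)
qed

lemma cas_orthogonal:
  assumes "i \<in> J" "j \<in> J"
  shows "((\<lambda>\<theta>. cas (of_int i * \<theta>) * cas (of_int j * \<theta>)) has_integral (if i = j then P else 0)) {0..P}"
    "((\<lambda>\<theta>. cas (- (of_int i * \<theta>)) * cas (- (of_int j * \<theta>))) has_integral (if i = j then P else 0)) {0..P}"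
proof -
  obtain a b where a: "of_int (i - j) * P = 2 * pi * of_int a" and b: "of_int (i + j) * P = 2 * pi * of_int b"
    using J_period[OF assms] by blast
  show "((\<lambda>\<theta>. cas (of_int i * \<theta>) * cas (of_int j * \<theta>)) has_integral (if i = j then P else 0)) {0..P}"
    using has_integral_cas_cas[OF P_pos, of "of_int i" "of_int j" a b] a b by simp
  show "((\<lambda>\<theta>. cas (- (of_int i * \<theta>)) * cas (- (of_int j * \<theta>))) has_integral (if i = j then P else 0)) {0..P}"
    using has_integral_cas_cas[OF P_pos, of "- of_int i" "- of_int j" "- a" "- b"] a b
    by (simp add: algebra_simps)
qed

lemmas parseval_plus = parseval[OF finite_J cas_orthogonal(1)]
  and parseval_minus = parseval[OF finite_J cas_orthogonal(2)]

text \<open>The quadratic form is diagonal in the coefficients: after Fubini, integration over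
  \<theta> removes all cross terms.\<close>

lemma second_variation_modes:
  "second_variation T u P (mode_section \<gamma>) =
     P * (\<Sum>j\<in>J. (\<gamma> j)\<^sup>2 * (integral {-T..T} (e (of_int j)) - 2 * \<mu> * (td T)\<^sup>2))"
proof -
  define x1 y1 x2 y2 where
    "x1 p = (\<Sum>j\<in>J. \<gamma> j * \<xi>' (of_int j) (fst p) * cas (- (of_int j * snd p)))" and
    "y1 p = (\<Sum>j\<in>J. \<gamma> j * \<eta>' (of_int j) (fst p) * cas (of_int j * snd p))" and
    "x2 p = (\<Sum>j\<in>J. \<gamma> j * (of_int j * \<xi> (of_int j) (fst p)) * cas (of_int j * snd p))" and
    "y2 p = (\<Sum>j\<in>J. \<gamma> j * (of_int j * \<eta> (of_int j) (fst p)) * cas (- (of_int j * snd p)))"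
    for p :: "real \<times> real"
  let ?d = "\<lambda>p. (x1 p)\<^sup>2 + (y1 p)\<^sup>2 + (- x2 p - K (fst p) * y \<gamma> p)\<^sup>2 + (y2 p + K (fst p) * x \<gamma> p)\<^sup>2
      - 2 * (A (fst p))\<^sup>2 * (x \<gamma> p)\<^sup>2 - 2 * (B (fst p))\<^sup>2 * (y \<gamma> p)\<^sup>2"
  have sv: "second_variation T u P (mode_section \<gamma>) = integral ({-T..T} \<times> {0..P}) ?d
    - \<mu> * (integral {0..P} (\<lambda>\<theta>. (x \<gamma> (- T, \<theta>))\<^sup>2 + (y \<gamma> (- T, \<theta>))\<^sup>2)
         + integral {0..P} (\<lambda>\<theta>. (x \<gamma> (T, \<theta>))\<^sup>2 + (y \<gamma> (T, \<theta>))\<^sup>2))"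
    by (subst second_variation_section[OF P_pos x_deriv y_deriv])
      (simp_all add: mode_section_def x1_def x2_def y1_def y2_def)
  have cont: "continuous_on X f" if "\<And>t. (f has_real_derivative f' t) (at t)" for f f' :: "real \<Rightarrow> real" and X
    using that by (meson DERIV_isCont continuous_at_imp_continuous_on)
  have cf: "continuous_on X (\<lambda>p. f (fst p))" if "\<And>Y. continuous_on Y f"
    for f :: "real \<Rightarrow> real" and X :: "(real \<times> real) set"
    by (rule continuous_on_compose2[OF that[of UNIV]]) (auto intro: continuous_intros)
  note * = cont[OF frame_deriv(1)] cont[OF frame_deriv(2)] cont[OF frame_deriv(3)] cont[OF frame_deriv(4)]
    cont[OF S_D_deriv(1)] cont[OF S_D_deriv(2)] cont[OF S_D_deriv(3)] cont[OF S_D_deriv(4)]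
  have c1: "continuous_on X (\<xi> j)" "continuous_on X (\<eta> j)" "continuous_on X (\<xi>' j)" "continuous_on X (\<eta>' j)"
    "continuous_on X A" "continuous_on X B" "continuous_on X K" for X j
    unfolding \<xi>_def[abs_def] \<eta>_def[abs_def] \<xi>'_def[abs_def] \<eta>'_def[abs_def] A_def[abs_def] B_def[abs_def] K_def[abs_def]
    by (intro continuous_intros *)+
  have "continuous_on (cbox (-T, 0) (T, P)) ?d"
    unfolding x1_def x2_def y1_def y2_def x_def y_def
    by (intro continuous_intros cf c1)
  from integral_prod_continuous[OF this]
  have iterated: "integral ({-T..T} \<times> {0..P}) ?d = integral {-T..T} (\<lambda>t. integral {0..P} (\<lambda>\<theta>. ?d (t, \<theta>)))"
    by (simp add: cbox_Pair_eq)
  have inner: "integral {0..P} (\<lambda>\<theta>. ?d (t, \<theta>)) = P * (\<Sum>j\<in>J. (\<gamma> j)\<^sup>2 * e (of_int j) t)" for t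
  proof -
    have alg: "P * (c * a1)\<^sup>2 + P * (c * a2)\<^sup>2 + P * (- c * a3)\<^sup>2 + P * (c * a4)\<^sup>2
        - 2 * \<alpha> * (P * (c * a5)\<^sup>2) - 2 * \<beta> * (P * (c * a6)\<^sup>2)
      = P * (c\<^sup>2 * (a1\<^sup>2 + a2\<^sup>2 + a3\<^sup>2 + a4\<^sup>2 - 2 * \<alpha> * a5\<^sup>2 - 2 * \<beta> * a6\<^sup>2))"
      for c a1 a2 a3 a4 a5 a6 \<alpha> \<beta> :: real
      by (simp add: power_mult_distrib algebra_simps)
    have h1: "- x2 (t, \<theta>) - K t * y \<gamma> (t, \<theta>) =
        (\<Sum>j\<in>J. (- \<gamma> j * (of_int j * \<xi> (of_int j) t + K t * \<eta> (of_int j) t)) * cas (of_int j * \<theta>))" for \<theta>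
      by (simp add: x2_def y_def sum_distrib_left sum_negf[symmetric] sum_subtractf[symmetric] algebra_simps)
    have h2: "y2 (t, \<theta>) + K t * x \<gamma> (t, \<theta>) =
        (\<Sum>j\<in>J. (\<gamma> j * (of_int j * \<eta> (of_int j) t + K t * \<xi> (of_int j) t)) * cas (- (of_int j * \<theta>)))" for \<theta>
      by (simp add: y2_def x_def sum_distrib_left sum.distrib[symmetric] algebra_simps)
    have "((\<lambda>\<theta>. ?d (t, \<theta>)) has_integral
        P * (\<Sum>j\<in>J. (\<gamma> j * \<xi>' (of_int j) t)\<^sup>2) + P * (\<Sum>j\<in>J. (\<gamma> j * \<eta>' (of_int j) t)\<^sup>2)
        + P * (\<Sum>j\<in>J. (- \<gamma> j * (of_int j * \<xi> (of_int j) t + K t * \<eta> (of_int j) t))\<^sup>2)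
        + P * (\<Sum>j\<in>J. (\<gamma> j * (of_int j * \<eta> (of_int j) t + K t * \<xi> (of_int j) t))\<^sup>2)
        - 2 * (A t)\<^sup>2 * (P * (\<Sum>j\<in>J. (\<gamma> j * \<xi> (of_int j) t)\<^sup>2))
        - 2 * (B t)\<^sup>2 * (P * (\<Sum>j\<in>J. (\<gamma> j * \<eta> (of_int j) t)\<^sup>2))) {0..P}"
      unfolding fst_conv h1 h2 unfolding x1_def y1_def x_def y_def fst_conv snd_conv
      by (intro has_integral_add has_integral_diff has_integral_mult_right parseval_plus parseval_minus)
    then have "integral {0..P} (\<lambda>\<theta>. ?d (t, \<theta>)) =
        P * (\<Sum>j\<in>J. (\<gamma> j * \<xi>' (of_int j) t)\<^sup>2) + P * (\<Sum>j\<in>J. (\<gamma> j * \<eta>' (of_int j) t)\<^sup>2)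
        + P * (\<Sum>j\<in>J. (- \<gamma> j * (of_int j * \<xi> (of_int j) t + K t * \<eta> (of_int j) t))\<^sup>2)
        + P * (\<Sum>j\<in>J. (\<gamma> j * (of_int j * \<eta> (of_int j) t + K t * \<xi> (of_int j) t))\<^sup>2)
        - 2 * (A t)\<^sup>2 * (P * (\<Sum>j\<in>J. (\<gamma> j * \<xi> (of_int j) t)\<^sup>2))
        - 2 * (B t)\<^sup>2 * (P * (\<Sum>j\<in>J. (\<gamma> j * \<eta> (of_int j) t)\<^sup>2))"
      by (rule integral_unique)
    also have "\<dots> = P * (\<Sum>j\<in>J. (\<gamma> j)\<^sup>2 * e (of_int j) t)"
      unfolding sum_distrib_left sum.distrib[symmetric] sum_subtractf[symmetric]
      by (intro sum.cong refl) (simp only: alg e_def)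
    finally show ?thesis .
  qed
  have outer: "integral {-T..T} (\<lambda>t. P * (\<Sum>j\<in>J. (\<gamma> j)\<^sup>2 * e (of_int j) t))
      = P * (\<Sum>j\<in>J. (\<gamma> j)\<^sup>2 * integral {-T..T} (e (of_int j)))"
    by (subst integral_mult_right, subst integral_sum)
      (auto intro!: finite_J integrable_continuous_interval continuous_intros e_continuous)
  have int: "integral ({-T..T} \<times> {0..P}) ?d = P * (\<Sum>j\<in>J. (\<gamma> j)\<^sup>2 * integral {-T..T} (e (of_int j)))"
    unfolding iterated inner outer ..
  \<comment> \<open>At both ends \<open>D = 0\<close> and \<open>S = 1\<close>, so only the
    \<open>N\<^sub>2\<close>-amplitude remains, with the same factor \<open>td T\<close> in every
    mode.\<close>
  have bd: "integral {0..P} (\<lambda>\<theta>. (x \<gamma> (\<tau>, \<theta>))\<^sup>2 + (y \<gamma> (\<tau>, \<theta>))\<^sup>2) = P * (\<Sum>j\<in>J. (\<gamma> j * td T)\<^sup>2)"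
    if "\<tau> = T \<or> \<tau> = - T" for \<tau>
  proof -
    have "(x \<gamma> (\<tau>, \<theta>))\<^sup>2 + (y \<gamma> (\<tau>, \<theta>))\<^sup>2 = (\<Sum>j\<in>J. (\<gamma> j * td T) * cas (of_int j * \<theta>))\<^sup>2" for \<theta>
      using that by (auto simp: x_def y_def \<xi>_def \<eta>_def S_D_end frame_parity)
    then show ?thesis by (simp only: integral_unique[OF parseval_plus])
  qed
  have "second_variation T u P (mode_section \<gamma>) = P * (\<Sum>j\<in>J. (\<gamma> j)\<^sup>2 * integral {-T..T} (e (of_int j)))
      - 2 * \<mu> * P * (\<Sum>j\<in>J. (\<gamma> j * td T)\<^sup>2)"
    using bd by (simp add: sv int)
  also have "\<dots> = P * (\<Sum>j\<in>J. (\<gamma> j)\<^sup>2 * (integral {-T..T} (e (of_int j)) - 2 * \<mu> * (td T)\<^sup>2))"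
    unfolding sum_distrib_left sum_subtractf[symmetric]
    by (intro sum.cong refl) (simp add: power_mult_distrib algebra_simps)
  finally show ?thesis .
qed

lemma second_variation_neg:
  assumes "j \<in> J" and "\<gamma> j \<noteq> 0"
  shows "second_variation T u P (mode_section \<gamma>) < 0"
proof -
  have neg: "integral {-T..T} (e (of_int i)) - 2 * \<mu> * (td T)\<^sup>2 < 0" if "i \<in> J" for i
    using e_integral_less J_less[OF that] by blast
  have "(\<Sum>j\<in>J. (\<gamma> j)\<^sup>2 * (integral {-T..T} (e (of_int j)) - 2 * \<mu> * (td T)\<^sup>2)) < (\<Sum>j\<in>J. 0)"
    using finite_J
  proof (rule sum_strict_mono_ex1)
    show "\<forall>i\<in>J. (\<gamma> i)\<^sup>2 * (integral {-T..T} (e (of_int i)) - 2 * \<mu> * (td T)\<^sup>2) \<le> 0"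
      using neg by (intro ballI mult_nonneg_nonpos) (auto intro: less_imp_le)
    show "\<exists>i\<in>J. (\<gamma> i)\<^sup>2 * (integral {-T..T} (e (of_int i)) - 2 * \<mu> * (td T)\<^sup>2) < 0"
      using assms neg[OF assms(1)] by (intro bexI[of _ j] mult_pos_neg) auto
  qed
  then show ?thesis
    unfolding second_variation_modes using P_pos by (simp add: mult_pos_neg)
qed

section \<open>Admissibility of the sections and the index bound\<close>

lemma mode_section_smooth: "smooth_up_to (strip T) (mode_section \<gamma>)"
proof -
  have g: "smooth (\<lambda>p. g (h p))" if "smooth h" for h :: "real \<times> real \<Rightarrow> real"
    unfolding g_def[abs_def]
    by (rule smooth_inverse_sqrt) (auto intro!: smooth_intros that simp: R_def[abs_def] power2_eq_square R_pos[unfolded R_def power2_eq_square])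
  have "smooth (\<lambda>p. nrm p (x \<gamma> p) (y \<gamma> p))"
    unfolding nrm_def x_def y_def \<xi>_def \<eta>_def ta_def tb_def tc_def td_def S_def D_def divide_inverse
    by (intro smooth_intros g)
  \<comment> \<open>The same formula on the whole plane is the smooth extension.\<close>
  then show ?thesis
    unfolding smooth_up_to_def smooth_def
    by (intro exI[of _ UNIV] exI[of _ "\<lambda>p. nrm p (x \<gamma> p) (y \<gamma> p)"]) (simp add: mode_section_def)
qed

lemma mode_section_normal:
  assumes "p \<in> strip T"
  shows "mode_section \<gamma> p \<bullet> dir_deriv T u p v = 0"
  using assms by (simp add: mode_section_def nrm_def dir_deriv_u fr_inner)

lemma sum_mode_section:
  "(\<Sum>j\<in>J. \<gamma> j *\<^sub>R mode_section (\<lambda>i. if i = j then 1 else 0)) = mode_section \<gamma>"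
proof
  fix p
  have sum_apply: "(\<Sum>j\<in>I. h j) p = (\<Sum>j\<in>I. h j p)" for I :: "int set" and h :: "int \<Rightarrow> real \<times> real \<Rightarrow> real ^ 4"
    by (induction I rule: infinite_finite_induct) auto
  have sum_nrm: "(\<Sum>j\<in>I. nrm p (a j) (b j)) = nrm p (\<Sum>j\<in>I. a j) (\<Sum>j\<in>I. b j)" for I :: "int set" and a b
    by (induction I rule: infinite_finite_induct) (auto simp: nrm_def fr_zero fr_add algebra_simps)
  have scale: "c *\<^sub>R nrm p a b = nrm p (c * a) (c * b)" for a b c
    by (simp add: nrm_def fr_scaleR mult_ac)
  show "(\<Sum>j\<in>J. \<gamma> j *\<^sub>R mode_section (\<lambda>i. if i = j then 1 else 0)) p = mode_section \<gamma> p"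
  proof (cases "p \<in> strip T")
    case True
    have "x (\<lambda>i. if i = j then 1 else 0) p = \<xi> (of_int j) (fst p) * cas (- (of_int j * snd p))"
      "y (\<lambda>i. if i = j then 1 else 0) p = \<eta> (of_int j) (fst p) * cas (of_int j * snd p)" if "j \<in> J" for j
      using that finite_J by (simp_all add: x_def y_def if_distrib[where f = "\<lambda>x. x * _"] cong: if_cong)
    then have "(\<Sum>j\<in>J. \<gamma> j *\<^sub>R mode_section (\<lambda>i. if i = j then 1 else 0)) p =
        (\<Sum>j\<in>J. nrm p (\<gamma> j * \<xi> (of_int j) (fst p) * cas (- (of_int j * snd p)))
           (\<gamma> j * \<eta> (of_int j) (fst p) * cas (of_int j * snd p)))"
      unfolding sum_apply using True by (intro sum.cong) (simp_all add: scaleR_fun_def mode_section_def scale mult_ac)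
    then show ?thesis
      using True by (simp add: sum_nrm mode_section_def x_def y_def)
  next
    case False
    then show ?thesis by (simp add: sum_apply scaleR_fun_def mode_section_def)
  qed
qed

lemma second_variation_zero: "second_variation T u P (\<lambda>p. 0) = 0"
proof -
  have "mode_section (\<lambda>j. 0) = (\<lambda>p. 0)"
    by (simp add: fun_eq_iff mode_section_def x_def y_def nrm_def fr_zero)
  then show ?thesis
    using second_variation_modes[of "\<lambda>j. 0"] by simp
qed

text \<open>The sections of the single modes span the negative space, and the domain is the whole
  surface. Independence follows from negativity as well.\<close>

lemma index_bound:
  assumes \<sigma>: "\<And>p \<gamma>. p \<in> strip T \<Longrightarrow> mode_section \<gamma> (\<sigma> p) = mode_section \<gamma> p"
    and dom: "surface_domain T u \<sigma> (strip T)"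
  shows "enat (card J) \<le> surface_index T u \<sigma> P"
proof -
  define E where "E j = mode_section (\<lambda>i. if i = j then 1 else 0)" for j
  have E: "(\<Sum>j\<in>J. \<gamma> j *\<^sub>R E j) = mode_section \<gamma>" for \<gamma>
    unfolding E_def by (rule sum_mode_section)
  \<comment> \<open>The zero section has second variation zero, whereas a nonzero coefficient would
    make it negative.\<close>
  have nz: "\<gamma> j = 0" if "mode_section \<gamma> = 0" "j \<in> J" for \<gamma> j
    using second_variation_neg[OF that(2), of \<gamma>] second_variation_zero that(1)
    by (auto simp: zero_fun_def)
  have inj: "inj_on E J"
  proof (rule inj_onI, rule ccontr)
    fix i j assume ij: "i \<in> J" "j \<in> J" "E i = E j" "i \<noteq> j"
    let ?\<gamma> = "\<lambda>m. (if m = i then 1 else 0) - (if m = j then 1 else 0 :: real)"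
    have "mode_section ?\<gamma> = (\<Sum>m\<in>J. (if m = i then E m else 0)) - (\<Sum>m\<in>J. (if m = j then E m else 0))"
      unfolding E[symmetric] sum_subtractf[symmetric]
      by (intro sum.cong refl) (auto simp: scaleR_left_diff_distrib)
    also have "\<dots> = 0" using ij finite_J by simp
    finally show False using nz[of ?\<gamma> i] ij by simp
  qed
  have ind: "independent (E ` J)"
  proof (rule independent_if_scalars_zero)
    show "finite (E ` J)" using finite_J by simp
    fix c v assume "(\<Sum>v\<in>E ` J. c v *\<^sub>R v) = 0" "v \<in> E ` J"
    then show "c v = 0"
      using nz[of "\<lambda>j. c (E j)"] E[of "\<lambda>j. c (E j)"] by (auto simp: sum.reindex[OF inj])
  qed
  have form: "\<exists>\<gamma>. X = mode_section \<gamma>" if "X \<in> span (E ` J)" for X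
  proof -
    have "X \<in> range (\<lambda>c. \<Sum>v\<in>E ` J. c v *\<^sub>R v)"
      using that span_finite[of "E ` J"] finite_J by simp
    then obtain c where "X = (\<Sum>v\<in>E ` J. c v *\<^sub>R v)" by blast
    also have "\<dots> = mode_section (\<lambda>j. c (E j))"
      by (simp add: sum.reindex[OF inj] E)
    finally show ?thesis by blast
  qed
  have cl: "closed (strip T)"
    by (simp add: strip_def closed_Times)
  have sub: "mode_section \<gamma> \<in> normal_sections T u \<sigma> (strip T)" for \<gamma>
  proof -
    have "closure {p. mode_section \<gamma> p \<noteq> 0} \<subseteq> strip T"
      by (rule closure_minimal[OF _ cl]) (auto simp: mode_section_def)
    then show ?thesis
      using mode_section_smooth mode_section_normal \<sigma>
      by (simp add: normal_sections_def) (simp add: mode_section_def)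
  qed
  have "second_variation T u P X < 0" if span: "X \<in> span (E ` J)" and "X \<noteq> 0" for X
  proof -
    obtain \<gamma> where X: "X = mode_section \<gamma>" using form[OF span] by blast
    have "\<exists>j\<in>J. \<gamma> j \<noteq> 0"
    proof (rule ccontr)
      assume "\<not> ?thesis"
      then have "mode_section \<gamma> = 0" unfolding E[symmetric] by simp
      then show False using that X by simp
    qed
    then show ?thesis using second_variation_neg X by blast
  qed
  moreover have "span (E ` J) \<subseteq> normal_sections T u \<sigma> (strip T)"
    using form sub by blast
  ultimately have "enat (dim (span (E ` J))) \<le> index_on T u \<sigma> P (strip T)"
    unfolding index_on_def using finite_J
    by (intro SUP_upper) (auto intro: subspace_span exI[of _ "E ` J"])
  also have "\<dots> \<le> surface_index T u \<sigma> P"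
    unfolding surface_index_def using dom by (intro SUP_upper) simp
  finally show ?thesis
    by (simp add: dim_eq_card_independent[OF ind] card_image[OF inj])
qed

end

section \<open>Interior Fraser-Sargent surfaces\<close>

text \<open>The equation is equivalent to \<open>k * tanh (k * t) * tanh (l * t) = l\<close>, whose
  left-hand side increases strictly from 0 to the limit \<open>k\<close>, and
  \<open>l < k\<close>.\<close>

lemma FS_T_ex1:
  fixes k l :: real
  assumes "0 < l" and "l < k"
  shows "\<exists>!t. 0 < t \<and> k * tanh (k * t) = l * coth (l * t)"
proof -
  define h where "h t = k * tanh (k * t) * tanh (l * t)" for t
  have eq: "k * tanh (k * t) = l * coth (l * t) \<longleftrightarrow> h t = l" if "0 < t" for t
  proof -
    have "tanh (l * t) \<noteq> 0" using that assms by simp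
    then show ?thesis
      by (auto simp: h_def coth_def tanh_def field_simps)
  qed
  have mono: "h s < h t" if "0 < s" "s < t" for s t
    unfolding h_def using that assms by (intro mult_strict_mono mult_strict_left_mono) auto
  have cont: "continuous_on X h" for X
    unfolding h_def by (intro continuous_intros) (auto simp: less_imp_neq[symmetric])
  have "(h \<longlongrightarrow> k * 1 * 1) at_top"
    unfolding h_def using assms
    by (intro tendsto_mult tendsto_const filterlim_compose[OF tanh_real_at_top]
        filterlim_tendsto_pos_mult_at_top[OF tendsto_const _ filterlim_ident]) auto
  then have "eventually (\<lambda>t. l < h t) at_top"
    using assms by (intro order_tendstoD) auto
  then have "eventually (\<lambda>t. l < h t \<and> 0 < t) at_top"
    by (rule eventually_conj) (rule eventually_gt_at_top)
  then obtain b where b: "l < h b" "0 < b"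
    using eventually_happens'[OF trivial_limit_at_top_linorder] by blast
  have "\<exists>t\<ge>0. t \<le> b \<and> h t = l"
    using IVT'[of h 0 l b] b assms cont by (auto simp: h_def)
  then obtain t where t: "0 \<le> t" "h t = l" by blast
  then have "0 < t" using assms by (cases "t = 0") (auto simp: h_def)
  show ?thesis
  proof (rule ex1I[of _ t])
    show "0 < t \<and> k * tanh (k * t) = l * coth (l * t)"
      using \<open>0 < t\<close> t eq by blast
    show "s = t" if "0 < s \<and> k * tanh (k * s) = l * coth (l * s)" for s
      using that t eq[of s] mono[of s t] mono[of t s] \<open>0 < t\<close> by (cases s t rule: linorder_cases) auto
  qed
qed

lemma fraser_sargent_FS_T:
  assumes "0 < l" and "l < k"
  shows "fraser_sargent (real k) (real l) (FS_T k l)"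
proof -
  have "0 < FS_T k l \<and> real k * tanh (real k * FS_T k l) = real l * coth (real l * FS_T k l)"
    unfolding FS_T_def by (rule theI'[OF FS_T_ex1]) (use assms in auto)
  then show ?thesis
    using assms by unfold_locales auto
qed

section \<open>Behaviour under a half turn\<close>

lemma cos_sin_half_turn:
  fixes n :: int
  shows "cos (of_int n * (\<theta> + pi)) = (if even n then 1 else - 1) * cos (of_int n * \<theta>)"
    "sin (of_int n * (\<theta> + pi)) = (if even n then 1 else - 1) * sin (of_int n * \<theta>)"
  using cos_npi_int[of n] sin_npi_int[of n]
  by (simp_all add: distrib_left cos_add sin_add mult.commute[of pi])

lemma cas_half_turn:
  fixes n :: int
  shows "cas (of_int n * (\<theta> + pi)) = (if even n then 1 else - 1) * cas (of_int n * \<theta>)"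
    "cas (- (of_int n * (\<theta> + pi))) = (if even n then 1 else - 1) * cas (- (of_int n * \<theta>))"
  unfolding cas_def cos_minus sin_minus cos_sin_half_turn by (simp_all add: algebra_simps)

lemma (in fraser_sargent) fr_half_turn:
  fixes m n :: nat
  assumes "k = real m" and "l = real n"
  shows "fr (\<theta> + pi) a b c d =
    fr \<theta> ((if even n then 1 else - 1) * a) ((if even n then 1 else - 1) * b)
      ((if even m then 1 else - 1) * c) ((if even m then 1 else - 1) * d)"
proof -
  have "cos (l * (\<theta> + pi)) = (if even n then 1 else - 1) * cos (l * \<theta>)"
    "sin (l * (\<theta> + pi)) = (if even n then 1 else - 1) * sin (l * \<theta>)"
    "cos (k * (\<theta> + pi)) = (if even m then 1 else - 1) * cos (k * \<theta>)"
    "sin (k * (\<theta> + pi)) = (if even m then 1 else - 1) * sin (k * \<theta>)"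
    using cos_sin_half_turn[of "int n" \<theta>] cos_sin_half_turn[of "int m" \<theta>]
    by (simp_all only: assms of_int_of_nat_eq even_of_nat)
  then show ?thesis
    unfolding fr_def by (cases "even m"; cases "even n") simp_all
qed

lemma (in fraser_sargent) FS_u_eq:
  assumes "k = real m" and "l = real n" and "T = FS_T m n"
  shows "FS_u m n = u"
proof -
  have r: "FS_r m n = r"
    by (simp only: FS_r_def r_def flip: assms)
  have "(1 / r) *\<^sub>R vector [k * sinh (l * t) * cos (l * \<theta>), k * sinh (l * t) * sin (l * \<theta>),
       l * cosh (k * t) * cos (k * \<theta>), l * cosh (k * t) * sin (k * \<theta>)] = u (t, \<theta>)" for t \<theta>
    by (simp add: u_def fr_def vec_eq_iff forall_4 axis_def vector_def)
  then show ?thesis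
    unfolding FS_u_def r assms(1,2)[symmetric] by (auto simp: fun_eq_iff)
qed

text \<open>The norm of \<open>u\<close> depends on \<open>t\<close> alone, so it is bounded
  although the strip is not. Connectedness of the quotient follows from that of the strip.\<close>

lemma (in fraser_sargent) surface_domain_strip:
  assumes "\<sigma> ` strip T = strip T"
  shows "surface_domain T u \<sigma> (strip T)"
proof -
  have "continuous_on {-T..T} (\<lambda>t. (k * sinh (l * t) / r)\<^sup>2 + (l * cosh (k * t) / r)\<^sup>2)"
    using r_pos by (intro continuous_intros) auto
  then have "bounded ((\<lambda>t. (k * sinh (l * t) / r)\<^sup>2 + (l * cosh (k * t) / r)\<^sup>2) ` {-T..T})"
    by (intro compact_imp_bounded compact_continuous_image) auto
  then obtain C where C: "\<And>t. t \<in> {-T..T} \<Longrightarrow> norm ((k * sinh (l * t) / r)\<^sup>2 + (l * cosh (k * t) / r)\<^sup>2) \<le> C"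
    unfolding bounded_iff by blast
  have "norm (u p) \<le> sqrt C" if "p \<in> strip T" for p
  proof (rule real_le_rsqrt)
    have "fst p \<in> {-T..T}" using that by (auto simp: strip_def)
    from C[OF this] show "(norm (u p))\<^sup>2 \<le> C"
      unfolding u_def fr_norm by simp
  qed
  then have bdd: "bounded (u ` strip T)"
    unfolding bounded_iff by blast
  have "connected (strip T)"
    unfolding strip_def by (intro convex_connected convex_Times) auto
  then have conn: "A = {} \<or> B = {}"
    if "openin (top_of_set (strip T)) A" "openin (top_of_set (strip T)) B" "A \<union> B = strip T" "A \<inter> B = {}" for A B
    using that unfolding connected_openin by blast
  have "(0, 0) \<in> strip T" using T_pos by (simp add: strip_def)
  then show ?thesis
    unfolding surface_domain_def using assms bdd conn by (intro conjI) (simp_all, blast+)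
qed

lemma FS_deck_strip: "FS_deck k ` strip T = strip T"
proof
  show "FS_deck k ` strip T \<subseteq> strip T"
    by (auto simp: FS_deck_def strip_def split: if_splits)
  show "strip T \<subseteq> FS_deck k ` strip T"
  proof
    fix p assume p: "p \<in> strip T"
    obtain t \<theta> where tp: "p = (t, \<theta>)" by (cases p)
    let ?q = "if odd k then (t, \<theta> - 2 * pi) else (- t, \<theta> - pi)"
    have "?q \<in> strip T" "p = FS_deck k ?q" using p by (auto simp: tp FS_deck_def strip_def)
    then show "p \<in> FS_deck k ` strip T" by blast
  qed
qed

section \<open>Counting the invariant modes for odd and for even \<open>k\<close>\<close>

theorem corollary1p3:
  fixes k l :: nat
  assumes "coprime k l" and "0 < l" and "l < k"
  shows "IFS_index k l \<ge> (if odd k then enat (2 * k - 1) else enat (k - 1))"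
proof (cases "odd k")
  case True
  define J where "J = {- (int k - 1)..int k - 1}"
  interpret fs: fraser_sargent_modes "real k" "real l" "FS_T k l" J "2 * pi"
  proof (intro fraser_sargent_modes.intro fraser_sargent_FS_T assms fraser_sargent_modes_axioms.intro conjI)
    show "\<exists>a. of_int (i - j) * (2 * pi) = 2 * pi * of_int a" "\<exists>b. of_int (i + j) * (2 * pi) = 2 * pi * of_int b" for i j
      by (metis mult.commute)+
  qed (auto simp: J_def)
  have "fs.mode_section \<gamma> (FS_deck k p) = fs.mode_section \<gamma> p" if "p \<in> strip (FS_T k l)" for \<gamma> p
  proof -
    obtain t \<theta> where p: "p = (t, \<theta>)" by (cases p)
    \<comment> \<open>A full turn is written as two half turns, whose signs cancel.\<close>
    have q: "FS_deck k (t, \<theta>) = (t, (\<theta> + pi) + pi)" using True by (simp add: FS_deck_def)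
    have "FS_deck k p \<in> strip (FS_T k l)" using that FS_deck_strip by blast
    moreover have "fs.x \<gamma> (FS_deck k p) = fs.x \<gamma> p" "fs.y \<gamma> (FS_deck k p) = fs.y \<gamma> p"
      unfolding fs.x_def fs.y_def p q fst_conv snd_conv cas_half_turn by (auto intro!: sum.cong)
    moreover have "fs.nrm (FS_deck k p) a b = fs.nrm p a b" for a b
      unfolding fs.nrm_def p q fst_conv snd_conv fs.fr_half_turn[OF refl refl] by simp
    ultimately show ?thesis
      using that by (simp add: fs.mode_section_def)
  qed
  then have "enat (card J) \<le> surface_index (FS_T k l) fs.u (FS_deck k) (2 * pi)"
    by (intro fs.index_bound fs.surface_domain_strip FS_deck_strip)
  moreover have "card J = 2 * k - 1"
    using assms by (simp add: J_def)
  ultimately show ?thesis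
    using True fs.FS_u_eq[OF refl refl refl] by (simp add: IFS_index_def FS_period_def)
next
  case False
  then have "odd l" using assms(1) by (meson coprime_common_divisor dvd_refl odd_one)
  \<comment> \<open>The odd integers from \<open>1 - k\<close> to \<open>k - 1\<close>,
    \<open>k\<close> in number.\<close>
  define J where "J = (\<lambda>i. 2 * int i + 1 - int k) ` {..<k}"
  have odd_J: "odd j" if "j \<in> J" for j
    using that False by (auto simp: J_def)
  interpret fs: fraser_sargent_modes "real k" "real l" "FS_T k l" J pi
  proof (intro fraser_sargent_modes.intro fraser_sargent_FS_T assms fraser_sargent_modes_axioms.intro conjI)
    fix i j assume "i \<in> J" "j \<in> J"
    then have "even (i - j)" "even (i + j)" using odd_J by auto
    then obtain a b where "i - j = 2 * a" "i + j = 2 * b" by (metis evenE)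
    then show "\<exists>a. of_int (i - j) * pi = 2 * pi * of_int a" "\<exists>b. of_int (i + j) * pi = 2 * pi * of_int b"
      by (auto intro!: exI[of _ a] exI[of _ b])
  qed (auto simp: J_def)
  have "fs.mode_section \<gamma> (FS_deck k p) = fs.mode_section \<gamma> p" if "p \<in> strip (FS_T k l)" for \<gamma> p
  proof -
    obtain t \<theta> where p: "p = (t, \<theta>)" by (cases p)
    have q: "FS_deck k (t, \<theta>) = (- t, \<theta> + pi)" using False by (simp add: FS_deck_def)
    have "FS_deck k p \<in> strip (FS_T k l)" using that FS_deck_strip by blast
    moreover have "fs.x \<gamma> (FS_deck k p) = fs.x \<gamma> p"
      unfolding fs.x_def p q fst_conv snd_conv cas_half_turn
      by (intro sum.cong refl) (simp add: odd_J fs.\<xi>_def fs.frame_parity fs.S_even)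
    \<comment> \<open>Since \<open>l\<close> is odd and \<open>k\<close> is even,
      \<open>N\<^sub>2\<close> changes sign under the deck transformation as well, so the section is
      invariant.\<close>
    moreover have "fs.y \<gamma> (FS_deck k p) = - fs.y \<gamma> p"
      unfolding fs.y_def p q fst_conv snd_conv cas_half_turn sum_negf[symmetric]
      by (intro sum.cong refl) (simp add: odd_J fs.\<eta>_def fs.frame_parity fs.S_even)
    moreover have "fs.nrm (FS_deck k p) a (- b) = fs.nrm p a b" for a b
      unfolding fs.nrm_def p q fst_conv snd_conv fs.fr_half_turn[OF refl refl]
      using False \<open>odd l\<close> by (simp add: fs.frame_parity)
    ultimately show ?thesis
      using that by (simp add: fs.mode_section_def)
  qed
  then have "enat (card J) \<le> surface_index (FS_T k l) fs.u (FS_deck k) pi"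
    by (intro fs.index_bound fs.surface_domain_strip FS_deck_strip)
  moreover have "card J = k"
    unfolding J_def by (subst card_image) (auto simp: inj_on_def)
  ultimately have *: "enat k \<le> IFS_index k l"
    using False fs.FS_u_eq[OF refl refl refl] by (simp add: IFS_index_def FS_period_def)
  \<comment> \<open>The modes give one more than the stated bound.\<close>
  have "enat (k - 1) \<le> IFS_index k l"
    by (rule order_trans[OF _ *]) simp
  then show ?thesis using False by simp
qed

end
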